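(* Let $n,d$ be positive integers with $n\geq d(d+2)$. Then $g(n,d)=n+d-2$.
   Context: All graphs are finite and simple. A graph $G$ is $d$-rigid if some (equivalently every) generic $d$-dimensional bar-and-joint framework $(G,p)$ (with $p:V(G)\to\mathbb{R}^d$ having coordinates algebraically independent over $\mathbb{Q}$) is rigid, i.e. admits no continuous edge-length-preserving motion that changes some pairwise distance between vertices. For a graph $G=(V,E)$, $\eta(G)=\min_{uv\notin E,\,u\neq v}(\deg_G(u)+\deg_G(v))$ (taken as $+\infty$ if $G$ is complete). For $n,d\in\mathbb{N}$, $g(n,d)$ is the smallest integer such that every $n$-vertex graph $G$ with $\eta(G)\geq g(n,d)$ is $d$-rigid. *)

theory Defs
  imports "HOL-Analysis.Analysis" "HOL-Library.Extended_Nat"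
begin

definition simple_graph :: "nat \<Rightarrow> nat set set \<Rightarrow> bool" where
  "simple_graph n E \<longleftrightarrow> (\<forall>e\<in>E. \<exists>u v. e = {u, v} \<and> u \<noteq> v \<and> u < n \<and> v < n)"

definition degree :: "nat set set \<Rightarrow> nat \<Rightarrow> nat" where
  "degree E u = card {v. {u, v} \<in> E}"

text \<open>eta(G) = min over non-adjacent distinct pairs of deg u + deg v; infinity if complete.\<close>
definition eta :: "nat \<Rightarrow> nat set set \<Rightarrow> enat" where
  "eta n E = (INF uv \<in> {(u, v). u < n \<and> v < n \<and> u \<noteq> v \<and> {u, v} \<notin> E}.
                 enat (degree E (fst uv) + degree E (snd uv)))"

definition sqdist :: "nat \<Rightarrow> (nat \<Rightarrow> nat \<Rightarrow> real) \<Rightarrow> nat \<Rightarrow> nat \<Rightarrow> real" where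
  "sqdist d p u v = (\<Sum>i<d. (p u i - p v i)^2)"

text \<open>Algebraic independence over Q of the family x indexed by the finite set I:
  no nonzero polynomial with rational coefficients (given by a finitely supported
  coefficient function on exponent vectors supported in I) vanishes at x.\<close>
definition alg_indep :: "'i set \<Rightarrow> ('i \<Rightarrow> real) \<Rightarrow> bool" where
  "alg_indep I x \<longleftrightarrow>
     (\<forall>c :: ('i \<Rightarrow> nat) \<Rightarrow> rat.
        finite {m. c m \<noteq> 0} \<longrightarrow>
        (\<forall>m. c m \<noteq> 0 \<longrightarrow> (\<forall>j. j \<notin> I \<longrightarrow> m j = 0)) \<longrightarrow>
        (\<Sum>m\<in>{m. c m \<noteq> 0}. of_rat (c m) * (\<Prod>j\<in>I. x j ^ m j)) = 0 \<longrightarrow>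
        (\<forall>m. c m = 0))"

definition generic :: "nat \<Rightarrow> nat \<Rightarrow> (nat \<Rightarrow> nat \<Rightarrow> real) \<Rightarrow> bool" where
  "generic n d p \<longleftrightarrow> alg_indep ({0..<n} \<times> {0..<d}) (\<lambda>(u, i). p u i)"

definition rigid_framework :: "nat \<Rightarrow> nat \<Rightarrow> nat set set \<Rightarrow> (nat \<Rightarrow> nat \<Rightarrow> real) \<Rightarrow> bool" where
  "rigid_framework n d E p \<longleftrightarrow>
     \<not> (\<exists>q :: real \<Rightarrow> nat \<Rightarrow> nat \<Rightarrow> real.
          (\<forall>u<n. \<forall>i<d. continuous_on {0..1} (\<lambda>t. q t u i)) \<and>
          (\<forall>u<n. \<forall>i<d. q 0 u i = p u i) \<and>
          (\<forall>t\<in>{0..1}. \<forall>u v. {u, v} \<in> E \<longrightarrow> sqdist d (q t) u v = sqdist d p u v) \<and>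
          (\<exists>t\<in>{0..1}. \<exists>u<n. \<exists>v<n. sqdist d (q t) u v \<noteq> sqdist d p u v))"

definition d_rigid :: "nat \<Rightarrow> nat \<Rightarrow> nat set set \<Rightarrow> bool" where
  "d_rigid n d E \<longleftrightarrow> (\<exists>p. generic n d p \<and> rigid_framework n d E p)"

definition g :: "nat \<Rightarrow> nat \<Rightarrow> nat" where
  "g n d = (LEAST k. \<forall>E. simple_graph n E \<longrightarrow> eta n E \<ge> enat k \<longrightarrow> d_rigid n d E)"

end

theory Submission
  imports Defs "HOL-Library.Function_Algebras" "HOL-Computational_Algebra.Polynomial"
begin

text \<open>
  Upper bound. Fix a generic placement \<open>p\<close> and pass to the closure of the graph in the generic
  rigidity matroid; the degree condition survives. Insert the vertices in a uniformly random
  order. A vertex with \<open>k\<close> earlier neighbours raises the rank by at least \<open>min d k\<close>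
  (0-extension), and by at least \<open>d + 1\<close> if \<open>k > d\<close> and these neighbours do not form a clique
  (1-extension). In a closed graph two cliques sharing \<open>d\<close> vertices merge, so a non-clique set of
  more than \<open>d\<close> neighbours becomes a clique for at most one choice of a deleted vertex. Hence a
  vertex of degree \<open>D\<close> with non-clique neighbourhood contributes at least
  \<open>d + 1/2 - d (d + 1) / (2 D)\<close> on average. If the closure is not complete, every neighbourhood
  is a non-clique of size \<open>> d\<close>, and for \<open>n \<ge> d (d + 2)\<close> these contributions add up to
  \<open>d n - d (d + 1) / 2\<close>, the rank of the complete graph. A graph of full generic rank is rigid
  because the difference of two nearby placements with equal edge lengths is an infinitesimal
  motion of their midpoint.

  Lower bound. A complete graph on \<open>n - 1\<close> vertices together with a vertex of degree \<open>d - 1\<close> has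
  \<open>\<eta> = n + d - 3\<close>, and that vertex can be rotated about its neighbours.
\<close>

subsection \<open>Finite spanning sets\<close>

text \<open>Passing to the closure serves two ends. Every missing edge becomes a row outside the
  span, which is what lets a 1-extension gain an extra unit, and cliques merge, which bounds how
  often that extra unit can fail. Write \<open>C = d (d + 1) / 2\<close>. The extra units add up to
  n / 2 and the losses to the sum of \<open>C / D\<close> over all vertices. The degree condition
  bounds the losses by \<open>2 C + C / \<delta>\<close>, where \<delta> > d is the minimum degree
  of the closure, hence by \<open>2 C + d / 2 = C + d (d + 2) / 2\<close>. So
  \<open>d (d + 2) \<le> n\<close> says exactly that everything beyond \<open>C\<close> is covered
  by n / 2. Genericity enters only in the form that a rational polynomial which is nonzero somewhere
  is nonzero at \<open>p\<close>. A continuous motion, however, passes through placements that need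
  not be generic. What survives there is the Gram matrix of a set of independent rows, because the
  pairwise distances determine it.\<close>

context vector_space
begin

lemma dim_mono_finite:
  assumes "finite T" "S \<subseteq> span T"
  shows "dim S \<le> dim T"
proof -
  obtain B where B: "B \<subseteq> T" "independent B" "T \<subseteq> span B" "card B = dim T"
    using basis_exists[of T] by blast
  have "S \<subseteq> span B"
    using assms(2) span_mono[OF B(3)] by (auto simp: span_span)
  then show ?thesis
    using dim_le_card[of S B] B(1,4) assms(1) finite_subset by metis
qed

lemma dim_insert_notin_span:
  assumes "finite S" "x \<notin> span S"
  shows "dim (insert x S) = Suc (dim S)"
proof -
  obtain B where B: "B \<subseteq> S" "independent B" "S \<subseteq> span B" "card B = dim S"
    using basis_exists[of S] by blast
  have fin: "finite B" using B(1) assms(1) finite_subset by blast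
  have span: "span B = span S"
    using B(1,3) by (metis span_eq span_superset order_trans)
  then have x: "x \<notin> span B" using assms(2) by simp
  have "independent (insert x B)" using x B(2) by (rule independent_insertI)
  moreover have "insert x S \<subseteq> span (insert x B)"
    using B(3) by (auto intro: span_base span_mono[THEN subsetD, of B])
  moreover have "insert x B \<subseteq> insert x S" using B(1) by auto
  ultimately have "card (insert x B) = dim (insert x S)"
    by (intro basis_card_eq_dim)
  moreover have "x \<notin> B" using x span_base by blast
  ultimately show ?thesis using fin B(4) by simp
qed

lemma subset_span_if_dim_le:
  assumes "finite T" "S \<subseteq> T" "dim T \<le> dim S"
  shows "T \<subseteq> span S"
proof
  fix x assume x: "x \<in> T"
  show "x \<in> span S"
  proof (rule ccontr)
    assume "x \<notin> span S"
    then have "dim (insert x S) = Suc (dim S)"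
      using assms finite_subset dim_insert_notin_span by blast
    moreover have "dim (insert x S) \<le> dim T"
      using assms x by (intro dim_mono_finite) (auto intro: span_base)
    ultimately show False using assms(3) by simp
  qed
qed

lemma span_image_finite:
  assumes "finite N" "x \<in> span (f ` N)"
  shows "\<exists>c. x = (\<Sum>e\<in>N. scale (c e) (f e))"
  using assms(2)
proof (induction rule: span_induct_alt)
  case base
  show ?case by (intro exI[of _ "\<lambda>_. 0"]) simp
next
  case (step k b y)
  then obtain e c where e: "e \<in> N" "b = f e" and c: "y = (\<Sum>e\<in>N. scale (c e) (f e))" by blast
  have "scale k b + y = (\<Sum>e'\<in>N. scale (if e' = e then k else 0) (f e')) + y"
    using e assms(1) by (simp add: if_distrib[of "\<lambda>a. scale a _"] sum.delta cong: if_cong)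
  also have "\<dots> = (\<Sum>e'\<in>N. scale ((if e' = e then k else 0) + c e') (f e'))"
    by (simp add: c sum.distrib scale_left_distrib)
  finally show ?case by (rule exI[of _ "\<lambda>e'. (if e' = e then k else 0) + c e'"])
qed

text \<open>Independence concerns the indexed family, not its image: if two indices carry the same
  vector, both sides fail. This form lets rows at different placements be compared through one index
  set \<open>P\<close>.\<close>

lemma indep_family_iff_dim:
  assumes "finite P"
  shows "(\<forall>c. (\<Sum>e\<in>P. scale (c e) (a e)) = 0 \<longrightarrow> (\<forall>e\<in>P. c e = 0)) \<longleftrightarrow> dim (a ` P) = card P"
    (is "?ind P \<longleftrightarrow> _")
  using assms
proof (induction P)
  case empty
  show ?case using dim_eq_card_independent[OF independent_empty] by simp
next
  case (insert x P)
  show ?case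
  proof (cases "a x \<in> span (a ` P)")
    case True
    then obtain u where u: "a x = (\<Sum>v\<in>a ` P. scale (u v) v)"
      using span_finite[of "a ` P"] insert.hyps by auto
    obtain B where B: "B \<subseteq> P" "a ` B = a ` P" "inj_on a B"
      using subset_image_inj[of "a ` P" a P] by (metis order_refl)
    define c where "c e = (if e = x then -1 else if e \<in> B then u (a e) else 0)" for e
    have "a x = (\<Sum>e\<in>B. scale (u (a e)) (a e))"
      using u B by (metis (no_types, lifting) sum.reindex_cong)
    also have "\<dots> = (\<Sum>e\<in>P. scale (c e) (a e))"
      using B(1) insert.hyps by (intro sum.mono_neutral_cong_left) (auto simp: c_def)
    finally have "(\<Sum>e\<in>insert x P. scale (c e) (a e)) = 0"
      using insert.hyps by (simp add: c_def)
    moreover have "c x \<noteq> 0" by (simp add: c_def)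
    ultimately have "\<not> ?ind (insert x P)" by blast
    moreover have "dim (a ` insert x P) \<le> card P"
    proof -
      have "dim (a ` insert x P) \<le> card (a ` P)"
        using True insert.hyps by (intro dim_le_card) (auto intro: span_base)
      also have "\<dots> \<le> card P" by (simp add: card_image_le insert.hyps)
      finally show ?thesis .
    qed
    ultimately show ?thesis using insert.hyps by auto
  next
    case False
    have "?ind (insert x P) \<longleftrightarrow> ?ind P"
    proof
      assume H: "?ind (insert x P)"
      show "?ind P"
      proof (intro allI impI)
        fix c assume c: "(\<Sum>e\<in>P. scale (c e) (a e)) = 0"
        have "(\<Sum>e\<in>P. scale ((c(x := 0)) e) (a e)) = (\<Sum>e\<in>P. scale (c e) (a e))"
          using insert.hyps by (intro sum.cong) auto
        then have "(\<Sum>e\<in>insert x P. scale ((c(x := 0)) e) (a e)) = 0"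
          using c insert.hyps by simp
        then have "\<forall>e\<in>insert x P. (c(x := 0)) e = 0" using H by blast
        then show "\<forall>e\<in>P. c e = 0" using insert.hyps by (metis fun_upd_other insertCI)
      qed
    next
      assume H: "?ind P"
      show "?ind (insert x P)"
      proof (intro allI impI)
        fix c assume c: "(\<Sum>e\<in>insert x P. scale (c e) (a e)) = 0"
        have eq: "scale (c x) (a x) = - (\<Sum>e\<in>P. scale (c e) (a e))"
          using c insert.hyps by (simp add: eq_neg_iff_add_eq_0)
        have in_span: "- (\<Sum>e\<in>P. scale (c e) (a e)) \<in> span (a ` P)"
          by (intro span_neg span_sum span_scale span_base) auto
        have cx: "c x = 0"
        proof (rule ccontr)
          assume "c x \<noteq> 0"
          then have "a x = scale (inverse (c x)) (scale (c x) (a x))" by simp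
          also have "\<dots> \<in> span (a ` P)" unfolding eq by (intro span_scale in_span)
          finally show False using False by simp
        qed
        then show "\<forall>e\<in>insert x P. c e = 0"
          using H c insert.hyps by auto
      qed
    qed
    moreover have "dim (a ` insert x P) = Suc (dim (a ` P))"
      using dim_insert_notin_span[OF _ False] insert.hyps by simp
    ultimately show ?thesis using insert by simp
  qed
qed

lemma obtain_indep_subfamily:
  assumes "finite P"
  obtains B where "B \<subseteq> P" "card B = dim (a ` P)" "dim (a ` B) = card B" "a ` P \<subseteq> span (a ` B)"
proof -
  obtain C where C: "C \<subseteq> a ` P" "independent C" "a ` P \<subseteq> span C" "card C = dim (a ` P)"
    using basis_exists[of "a ` P"] by blast
  obtain B where B: "B \<subseteq> P" "inj_on a B" "C = a ` B"
    using iffD1[OF subset_image_inj C(1)] by blast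
  have "card B = card C" using B(2,3) card_image by metis
  moreover have "dim (a ` B) = card C" using dim_eq_card_independent[OF C(2)] B(3) by simp
  ultimately show ?thesis
    using that[of B] B(1,3) C(3,4) by metis
qed

end

text \<open>Functions under pointwise operations, a space of possibly infinite dimension; dimensions
  are therefore taken of finite sets of vectors.\<close>

interpretation fv: vector_space "\<lambda>(c::real) (f::'a \<Rightarrow> real) x. c * f x"
  by unfold_locales (auto simp: fun_eq_iff algebra_simps)

lemma sum_fun_apply: "(\<Sum>e\<in>P. f e) x = (\<Sum>e\<in>P. f e x)" for f :: "'e \<Rightarrow> 'a \<Rightarrow> real"
  by (induction P rule: infinite_finite_induct) auto

lemma fv_indep_iff:
  assumes "finite P"
  shows "fv.dim (a ` P) = card P \<longleftrightarrow>
    (\<forall>c. (\<forall>j. (\<Sum>e\<in>P. c e * a e j) = 0) \<longrightarrow> (\<forall>e\<in>P. c e = 0))"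
  using fv.indep_family_iff_dim[OF assms, of a] by (simp add: fun_eq_iff sum_fun_apply)

text \<open>Elimination by induction on the equations \<open>Q\<close>: an equation with a pivot
  removes one unknown. The lemma supplies affine dependencies of points and vectors orthogonal to
  few given ones.\<close>

lemma exists_linear_dependency:
  fixes f :: "'a \<Rightarrow> 'q \<Rightarrow> real"
  assumes "finite Q" "finite A" "card Q < card A"
  obtains c where "\<exists>a\<in>A. c a \<noteq> 0" "\<And>q. q \<in> Q \<Longrightarrow> (\<Sum>a\<in>A. c a * f a q) = 0"
proof -
  have "\<exists>c. (\<exists>a\<in>A. c a \<noteq> 0) \<and> (\<forall>q\<in>Q. (\<Sum>a\<in>A. c a * f a q) = 0)"
    using assms
  proof (induction Q arbitrary: A f)
    case empty
    then have "A \<noteq> {}" by auto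
    then show ?case by (intro exI[of _ "\<lambda>_. 1"]) auto
  next
    case (insert q Q)
    show ?case
    proof (cases "\<exists>a\<in>A. f a q \<noteq> 0")
      case False
      have "card Q < card A" using insert by auto
      then obtain c where "\<exists>a\<in>A. c a \<noteq> 0" "\<forall>q\<in>Q. (\<Sum>a\<in>A. c a * f a q) = 0"
        using insert.IH[OF insert.prems(1), of f] by blast
      then show ?thesis using False by (intro exI[of _ c]) auto
    next
      case True
      then obtain b where b: "b \<in> A" "f b q \<noteq> 0" by blast
      let ?A = "A - {b}"
      let ?f = "\<lambda>a r. f a r - f a q / f b q * f b r"
      have "card Q < card ?A" using insert b by (simp add: card_Diff_singleton)
      then obtain c where c: "\<exists>a\<in>?A. c a \<noteq> 0" "\<forall>r\<in>Q. (\<Sum>a\<in>?A. c a * ?f a r) = 0"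
        using insert.IH[of ?A ?f] insert.prems by auto
      \<comment> \<open>Solving equation \<open>q\<close> for the coefficient of the pivot
        \<open>b\<close> turns every other equation into its eliminated form in
        \<open>?f\<close>.\<close>
      define c' where "c' = c(b := - (\<Sum>a\<in>?A. c a * f a q) / f b q)"
      have expand: "(\<Sum>a\<in>A. c' a * f a r) = (\<Sum>a\<in>?A. c a * ?f a r)" for r
      proof -
        have "(\<Sum>a\<in>A. c' a * f a r) = c' b * f b r + (\<Sum>a\<in>?A. c' a * f a r)"
          using insert.prems b by (simp add: sum.remove)
        also have "(\<Sum>a\<in>?A. c' a * f a r) = (\<Sum>a\<in>?A. c a * f a r)"
          by (intro sum.cong) (auto simp: c'_def)
        also have "c' b * f b r + \<dots> =
            (\<Sum>a\<in>?A. c a * f a r) - (\<Sum>a\<in>?A. c a * f a q) * (f b r / f b q)"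
          by (simp add: c'_def)
        also have "\<dots> = (\<Sum>a\<in>?A. c a * f a r - c a * f a q * (f b r / f b q))"
          by (simp only: sum_subtractf sum_distrib_right)
        also have "\<dots> = (\<Sum>a\<in>?A. c a * ?f a r)"
          by (intro sum.cong) (simp_all add: right_diff_distrib)
        finally show ?thesis .
      qed
      have "(\<Sum>a\<in>A. c' a * f a q) = 0" unfolding expand using b(2) by simp
      then have "\<forall>r\<in>insert q Q. (\<Sum>a\<in>A. c' a * f a r) = 0" using c(2) expand by auto
      moreover have "\<exists>a\<in>A. c' a \<noteq> 0" using c(1) by (auto simp: c'_def)
      ultimately show ?thesis by blast
    qed
  qed
  then show ?thesis using that by blast
qed

subsection \<open>Rational polynomial functions and algebraic independence\<close>

text \<open>Polynomial functions over the rationals, given by closure rules so that iterated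
  elimination visibly stays polynomial. A normal form is needed only for the comparison with
  \<open>alg_indep\<close>.\<close>

inductive_set ratpoly :: "'i set \<Rightarrow> (('i \<Rightarrow> real) \<Rightarrow> real) set" for I where
  const: "(\<lambda>_. of_rat a) \<in> ratpoly I"
| var: "i \<in> I \<Longrightarrow> (\<lambda>x. x i) \<in> ratpoly I"
| add: "f \<in> ratpoly I \<Longrightarrow> h \<in> ratpoly I \<Longrightarrow> (\<lambda>x. f x + h x) \<in> ratpoly I"
| mult: "f \<in> ratpoly I \<Longrightarrow> h \<in> ratpoly I \<Longrightarrow> (\<lambda>x. f x * h x) \<in> ratpoly I"

lemma ratpoly_0: "(\<lambda>_. 0) \<in> ratpoly I"
  using ratpoly.const[of 0] by simp

lemma ratpoly_1: "(\<lambda>_. 1) \<in> ratpoly I"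
  using ratpoly.const[of 1] by simp

lemma ratpoly_diff: "f \<in> ratpoly I \<Longrightarrow> h \<in> ratpoly I \<Longrightarrow> (\<lambda>x. f x - h x) \<in> ratpoly I"
  using ratpoly.add[OF _ ratpoly.mult[OF ratpoly.const[of "-1"]], of f I h] by simp

lemma continuous_on_ratpoly:
  assumes "f \<in> ratpoly I" "\<And>i. i \<in> I \<Longrightarrow> continuous_on S (\<lambda>t. y t i)"
  shows "continuous_on S (\<lambda>t. f (y t))"
  using assms by (induction rule: ratpoly.induct) (auto intro: continuous_on_add continuous_on_mult)

section \<open>Polynomial functions as sums of monomials\<close>

definition monoms_val :: "'i set \<Rightarrow> (rat \<times> ('i \<Rightarrow> nat)) list \<Rightarrow> ('i \<Rightarrow> real) \<Rightarrow> real" where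
  "monoms_val I ms x = (\<Sum>(a, e)\<leftarrow>ms. of_rat a * (\<Prod>i\<in>I. x i ^ e i))"

lemma monoms_val_simps [simp]:
  "monoms_val I [] x = 0"
  "monoms_val I ((a, e) # ms) x = of_rat a * (\<Prod>i\<in>I. x i ^ e i) + monoms_val I ms x"
  "monoms_val I (ms @ ms') x = monoms_val I ms x + monoms_val I ms' x"
  by (simp_all add: monoms_val_def)

lemma monoms_val_scale:
  "monoms_val I (map (\<lambda>(b, e'). (a * b, \<lambda>i. e i + e' i)) ms) x =
    of_rat a * (\<Prod>i\<in>I. x i ^ e i) * monoms_val I ms x"
  by (induction ms) (auto simp: of_rat_mult power_add prod.distrib algebra_simps)

lemma monoms_val_mult:
  assumes "\<forall>(a, e)\<in>set ms. \<forall>i. i \<notin> I \<longrightarrow> e i = 0" "\<forall>(a, e)\<in>set ms'. \<forall>i. i \<notin> I \<longrightarrow> e i = 0"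
  shows "\<exists>qs. (\<forall>(a, e)\<in>set qs. \<forall>i. i \<notin> I \<longrightarrow> e i = 0) \<and>
    (\<forall>x. monoms_val I qs x = monoms_val I ms x * monoms_val I ms' x)"
  using assms(1)
proof (induction ms)
  case Nil
  show ?case by (intro exI[of _ "[]"]) simp
next
  case (Cons m ms)
  obtain a e where m: "m = (a, e)" by fastforce
  obtain qs where qs: "\<forall>(a, e)\<in>set qs. \<forall>i. i \<notin> I \<longrightarrow> e i = 0"
      "\<forall>x. monoms_val I qs x = monoms_val I ms x * monoms_val I ms' x"
    using Cons by auto
  let ?q = "map (\<lambda>(b, e'). (a * b, \<lambda>i. e i + e' i)) ms' @ qs"
  have "\<forall>(a, e)\<in>set ?q. \<forall>i. i \<notin> I \<longrightarrow> e i = 0"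
    using qs(1) assms(2) Cons.prems m by fastforce
  moreover have "\<forall>x. monoms_val I ?q x = monoms_val I (m # ms) x * monoms_val I ms' x"
    using qs(2) m by (simp add: monoms_val_scale distrib_right)
  ultimately show ?case by blast
qed

lemma ratpoly_eq_monoms_val:
  assumes "finite I" "f \<in> ratpoly I"
  shows "\<exists>ms. (\<forall>(a, e)\<in>set ms. \<forall>i. i \<notin> I \<longrightarrow> e i = 0) \<and> (\<forall>x. f x = monoms_val I ms x)"
  using assms(2)
proof (induction rule: ratpoly.induct)
  case (const a)
  show ?case by (intro exI[of _ "[(a, \<lambda>_. 0)]"]) simp
next
  case (var i)
  have "(\<Prod>j\<in>I. x j ^ (if j = i then 1 else 0)) = x i" for x :: "_ \<Rightarrow> real"
    using var assms(1) by (simp add: if_distrib[of "\<lambda>k. _ ^ k"] prod.delta cong: if_cong)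
  then show ?case using var
    by (intro exI[of _ "[(1, \<lambda>j. if j = i then 1 else 0)]"]) auto
next
  case (add f h)
  then obtain ms ms' where
    "\<forall>(a, e)\<in>set ms. \<forall>i. i \<notin> I \<longrightarrow> e i = 0" "\<forall>x. f x = monoms_val I ms x"
    "\<forall>(a, e)\<in>set ms'. \<forall>i. i \<notin> I \<longrightarrow> e i = 0" "\<forall>x. h x = monoms_val I ms' x"
    by blast
  then show ?case by (intro exI[of _ "ms @ ms'"]) auto
next
  case (mult f h)
  then obtain ms ms' where
    "\<forall>(a, e)\<in>set ms. \<forall>i. i \<notin> I \<longrightarrow> e i = 0" "\<forall>x. f x = monoms_val I ms x"
    "\<forall>(a, e)\<in>set ms'. \<forall>i. i \<notin> I \<longrightarrow> e i = 0" "\<forall>x. h x = monoms_val I ms' x"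
    by blast
  then show ?case using monoms_val_mult[of ms I ms'] by (metis (no_types, lifting))
qed

text \<open>Lists of monomials may repeat an exponent, which makes addition mere appending. Here
  equal exponents are collected into a coefficient function of the kind \<open>alg_indep\<close>
  speaks of.\<close>

lemma monoms_val_collect:
  fixes ms :: "(rat \<times> ('i \<Rightarrow> nat)) list"
  defines "c \<equiv> \<lambda>m. \<Sum>(a, e)\<leftarrow>ms. if e = m then a else 0"
  assumes "finite M" "snd ` set ms \<subseteq> M"
  shows "(\<Sum>m\<in>M. of_rat (c m) * (\<Prod>i\<in>I. x i ^ m i)) = monoms_val I ms x"
  unfolding c_def using assms(3)
proof (induction ms)
  case (Cons am ms)
  obtain a e where am: "am = (a, e)" by fastforce
  have "(\<Sum>m\<in>M. of_rat (\<Sum>(a, e)\<leftarrow>am # ms. if e = m then a else 0) * (\<Prod>i\<in>I. x i ^ m i)) =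
    (\<Sum>m\<in>M. (if e = m then of_rat a * (\<Prod>i\<in>I. x i ^ m i) else 0)) +
    (\<Sum>m\<in>M. of_rat (\<Sum>(a, e)\<leftarrow>ms. if e = m then a else 0) * (\<Prod>i\<in>I. x i ^ m i))"
    unfolding sum.distrib[symmetric] by (intro sum.cong) (auto simp: am of_rat_add distrib_right)
  also have "(\<Sum>m\<in>M. (if e = m then of_rat a * (\<Prod>i\<in>I. x i ^ m i) else 0)) =
      of_rat a * (\<Prod>i\<in>I. x i ^ e i)"
    using assms(2) Cons.prems am by (simp add: sum.delta)
  finally show ?case using Cons am by simp
qed simp

text \<open>If \<open>f\<close> vanished at \<open>x\<close>, independence would make all collected
  coefficients zero and hence \<open>f\<close> zero everywhere. So one witness \<open>y\<close>,
  however special, transfers a polynomial inequation to every generic point.\<close>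

lemma ratpoly_nonzero_at_alg_indep:
  assumes "finite I" "f \<in> ratpoly I" "alg_indep I x" "f y \<noteq> 0"
  shows "f x \<noteq> 0"
proof
  assume fx: "f x = 0"
  obtain ms where ms: "\<forall>(a, e)\<in>set ms. \<forall>i. i \<notin> I \<longrightarrow> e i = 0" "\<And>x. f x = monoms_val I ms x"
    using ratpoly_eq_monoms_val[OF assms(1,2)] by blast
  define c where "c = (\<lambda>m. \<Sum>(a, e)\<leftarrow>ms. if e = m then a else 0)"
  have zero: "c m = 0" if "m \<notin> snd ` set ms" for m
  proof -
    have "(\<lambda>(a, e). if e = m then a else 0) p = 0" if "p \<in> set ms" for p
      using that \<open>m \<notin> snd ` set ms\<close> by (force split: prod.split)
    then have "map (\<lambda>(a, e). if e = m then a else 0) ms = map (\<lambda>_. 0) ms"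
      by (intro map_cong) auto
    then show ?thesis unfolding c_def by (simp only: sum_list_0)
  qed
  then have sub: "{m. c m \<noteq> 0} \<subseteq> snd ` set ms" by blast
  then have fin: "finite {m. c m \<noteq> 0}" by (rule finite_subset) simp
  have eq: "(\<Sum>m | c m \<noteq> 0. of_rat (c m) * (\<Prod>i\<in>I. z i ^ m i)) = f z" for z
  proof -
    have "(\<Sum>m | c m \<noteq> 0. of_rat (c m) * (\<Prod>i\<in>I. z i ^ m i)) =
        (\<Sum>m\<in>snd ` set ms. of_rat (c m) * (\<Prod>i\<in>I. z i ^ m i))"
      using sub by (intro sum.mono_neutral_left) auto
    also have "\<dots> = f z"
      using monoms_val_collect[of "snd ` set ms" ms z I] ms(2) unfolding c_def by simp
    finally show ?thesis .
  qed
  have "\<forall>m. c m \<noteq> 0 \<longrightarrow> (\<forall>j. j \<notin> I \<longrightarrow> m j = 0)"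
  proof (intro allI impI)
    fix m j assume "c m \<noteq> 0" "j \<notin> I"
    from \<open>c m \<noteq> 0\<close> have "m \<in> snd ` set ms" using zero by metis
    then obtain p where p: "m = snd p" "p \<in> set ms" by (rule imageE)
    have "\<forall>i. i \<notin> I \<longrightarrow> snd p i = 0" using bspec[OF ms(1) p(2)] by (cases p) simp
    then show "m j = 0" using \<open>j \<notin> I\<close> p(1) by metis
  qed
  then have "\<forall>m. c m = 0"
    using assms(3)[unfolded alg_indep_def, THEN spec, THEN mp, OF fin] eq[of x] fx by simp
  then show False using eq[of y] assms(4) by simp
qed

section \<open>Existence of algebraically independent points\<close>

lemma countable_finite_support_coeffs:
  fixes J :: "'i set"
  assumes "finite J"
  shows "countable {c :: ('i \<Rightarrow> nat) \<Rightarrow> rat. finite {m. c m \<noteq> 0} \<and> (\<forall>m. c m \<noteq> 0 \<longrightarrow> (\<forall>j. j \<notin> J \<longrightarrow> m j = 0))}"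
    (is "countable ?C")
proof -
  define M where "M = {m :: 'i \<Rightarrow> nat. \<forall>j. j \<notin> J \<longrightarrow> m j = 0}"
  have "countable (Pi\<^sub>E J (\<lambda>_. UNIV :: nat set))"
    using assms by (intro countable_PiE) auto
  moreover have "inj_on (\<lambda>m. restrict m J) M"
  proof (rule inj_onI)
    fix a b assume ab: "a \<in> M" "b \<in> M" and eq: "restrict a J = restrict b J"
    show "a = b"
    proof
      fix i
      show "a i = b i"
      proof (cases "i \<in> J")
        case True
        then show ?thesis using fun_cong[OF eq, of i] by simp
      next
        case False
        then show ?thesis using ab by (simp add: M_def)
      qed
    qed
  qed
  moreover have "(\<lambda>m. restrict m J) ` M \<subseteq> Pi\<^sub>E J (\<lambda>_. UNIV)" by auto
  ultimately have "countable M"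
    using countable_subset countable_image_inj_on[of "\<lambda>m. restrict m J" M] by blast
  then have "countable (M \<times> (UNIV :: rat set))" by simp
  then have "countable {F. F \<subseteq> M \<times> (UNIV :: rat set) \<and> finite F}"
    using countable_Collect_finite_subset[of "M \<times> (UNIV :: rat set)"] by (simp add: conj_commute)
  \<comment> \<open>\<open>G\<close> sends a coefficient function to the finite graph of its nonzero
    part, an element of a countable set.\<close>
  moreover define G where "G c = {(m, c m) | m. c m \<noteq> 0}" for c :: "('i \<Rightarrow> nat) \<Rightarrow> rat"
  have "G ` ?C \<subseteq> {F. F \<subseteq> M \<times> UNIV \<and> finite F}"
  proof safe
    fix c :: "('i \<Rightarrow> nat) \<Rightarrow> rat" assume fin: "finite {m. c m \<noteq> 0}"
    have "G c = (\<lambda>m. (m, c m)) ` {m. c m \<noteq> 0}" by (auto simp: G_def)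
    then show "finite (G c)" using fin by simp
  qed (auto simp: G_def M_def)
  moreover have "inj_on G ?C"
  proof (rule inj_onI)
    fix a b assume eq: "G a = G b"
    have mem: "(m, k) \<in> G c \<longleftrightarrow> c m = k \<and> k \<noteq> 0" for m k c by (auto simp: G_def)
    have "a m = k \<and> k \<noteq> 0 \<longleftrightarrow> b m = k \<and> k \<noteq> 0" for m k
      unfolding mem[symmetric] eq ..
    then have "a m = b m" for m by metis
    then show "a = b" by blast
  qed
  ultimately show ?thesis using countable_subset countable_image_inj_on[of G ?C] by blast
qed

text \<open>Coordinates are added one at a time. Each of the countably many nonzero coefficient
  functions forbids only finitely many values of the new coordinate, and the reals are
  uncountable.\<close>

lemma exists_alg_indep:
  fixes I :: "'a set"
  assumes "finite I"
  shows "\<exists>x. alg_indep I x"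
  using assms
proof (induction I)
  case empty
  have "alg_indep ({} :: 'a set) (\<lambda>_. 0)" unfolding alg_indep_def
  proof (intro allI impI)
    fix c :: "('a \<Rightarrow> nat) \<Rightarrow> rat" and m
    assume "finite {m. c m \<noteq> 0}" and sup: "\<forall>m. c m \<noteq> 0 \<longrightarrow> (\<forall>j. j \<notin> {} \<longrightarrow> m j = 0)"
      and sum: "(\<Sum>m\<in>{m. c m \<noteq> 0}. of_rat (c m) * (\<Prod>j\<in>{}. 0 ^ m j)) = (0::real)"
    have sub: "{m. c m \<noteq> 0} \<subseteq> {\<lambda>_. 0}" using sup by auto
    have "(\<Sum>m\<in>{m. c m \<noteq> 0}. of_rat (c m)) = (of_rat (c (\<lambda>_. 0)) :: real)"
    proof (cases "c (\<lambda>_. 0) = 0")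
      case True
      then have "{m. c m \<noteq> 0} = {}" using sub by auto
      then show ?thesis using True by simp
    next
      case False
      then have "{m. c m \<noteq> 0} = {\<lambda>_. 0}" using sub by auto
      then show ?thesis by simp
    qed
    then have "c (\<lambda>_. 0) = 0" using sum by simp
    then show "c m = 0" using sub by auto
  qed
  then show ?case by blast
next
  case (insert j I)
  then obtain x where x: "alg_indep I x" by blast
  define Cs where "Cs = {c :: ('a \<Rightarrow> nat) \<Rightarrow> rat. finite {m. c m \<noteq> 0} \<and>
    (\<forall>m. c m \<noteq> 0 \<longrightarrow> (\<forall>i. i \<notin> insert j I \<longrightarrow> m i = 0))}"
  \<comment> \<open>\<open>P c\<close> is the polynomial of \<open>c\<close> with the old
    coordinates substituted and the new coordinate as its variable.\<close>
  define P where "P c = (\<Sum>m | c m \<noteq> 0. monom (of_rat (c m) * (\<Prod>i\<in>I. x i ^ m i)) (m j))"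
    for c :: "('a \<Rightarrow> nat) \<Rightarrow> rat"
  have P_nz: "P c \<noteq> 0" if c: "c \<in> Cs" "c m0 \<noteq> 0" for c m0
  proof
    assume P0: "P c = 0"
    \<comment> \<open>The coefficient of degree \<open>m0 j\<close> in \<open>P c\<close> is itself
      a polynomial value at the old point. Its coefficient function is \<open>c'\<close>, with the
      exponent at \<open>j\<close> reset to 0 so that it is supported on \<open>I\<close>.\<close>
    define c' where "c' m = (if m j = 0 then c (m(j := m0 j)) else 0)" for m
    have fin: "finite {m. c m \<noteq> 0}" using c by (simp add: Cs_def)
    have upd: "m(j := m0 j) = m" if "m j = m0 j" for m using that by (metis fun_upd_triv)
    have bij: "bij_betw (\<lambda>m. m(j := m0 j)) {m. c' m \<noteq> 0} {m. c m \<noteq> 0 \<and> m j = m0 j}"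
      by (rule bij_betw_byWitness[where f' = "\<lambda>m. m(j := 0)"])
        (auto simp: c'_def upd split: if_splits)
    have fin': "finite {m. c' m \<noteq> 0}"
      using bij_betw_finite[OF bij] fin by simp
    have "0 = coeff (P c) (m0 j)" using P0 by simp
    also have "\<dots> = (\<Sum>m | c m \<noteq> 0. if m j = m0 j then of_rat (c m) * (\<Prod>i\<in>I. x i ^ m i) else 0)"
      by (simp add: P_def coeff_sum)
    also have "\<dots> = (\<Sum>m\<in>{m. c m \<noteq> 0 \<and> m j = m0 j}. of_rat (c m) * (\<Prod>i\<in>I. x i ^ m i))"
      using fin by (simp add: sum.If_cases Int_def)
    also have "\<dots> = (\<Sum>m | c' m \<noteq> 0. of_rat (c (m(j := m0 j))) * (\<Prod>i\<in>I. x i ^ (m(j := m0 j)) i))"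
      by (rule sum.reindex_bij_betw[OF bij, symmetric])
    also have "\<dots> = (\<Sum>m | c' m \<noteq> 0. of_rat (c' m) * (\<Prod>i\<in>I. x i ^ m i))"
    proof (rule sum.cong[OF refl])
      fix m assume "m \<in> {m. c' m \<noteq> 0}"
      moreover have "(\<Prod>i\<in>I. x i ^ (m(j := m0 j)) i) = (\<Prod>i\<in>I. x i ^ m i)"
        using insert.hyps by (intro prod.cong) auto
      ultimately show "of_rat (c (m(j := m0 j))) * (\<Prod>i\<in>I. x i ^ (m(j := m0 j)) i) =
          of_rat (c' m) * (\<Prod>i\<in>I. x i ^ m i)"
        by (auto simp: c'_def split: if_splits)
    qed
    finally have "(\<Sum>m | c' m \<noteq> 0. of_rat (c' m) * (\<Prod>i\<in>I. x i ^ m i)) = 0" by simp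
    moreover have "\<forall>m. c' m \<noteq> 0 \<longrightarrow> (\<forall>i. i \<notin> I \<longrightarrow> m i = 0)"
    proof (intro allI impI)
      fix m i assume m: "c' m \<noteq> 0" and i: "i \<notin> I"
      show "m i = 0"
      proof (cases "i = j")
        case True
        then show ?thesis using m by (auto simp: c'_def split: if_splits)
      next
        case False
        have "c (m(j := m0 j)) \<noteq> 0" using m by (auto simp: c'_def split: if_splits)
        then have "(m(j := m0 j)) i = 0" using c(1) i False unfolding Cs_def by blast
        then show ?thesis using False by simp
      qed
    qed
    ultimately have "\<forall>m. c' m = 0"
      using x[unfolded alg_indep_def, THEN spec, THEN mp, OF fin'] by blast
    then have "c' (m0(j := 0)) = 0" by blast
    then show False using c(2) by (simp add: c'_def upd)
  qed
  have "countable (\<Union>c\<in>Cs - {\<lambda>_. 0}. {t. poly (P c) t = 0})"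
  proof (rule countable_UN)
    show "countable (Cs - {\<lambda>_. 0})"
      using countable_finite_support_coeffs[of "insert j I"] insert.hyps unfolding Cs_def by simp
    fix c assume c: "c \<in> Cs - {\<lambda>_. 0}"
    then obtain m where "c m \<noteq> 0" by fastforce
    then have "P c \<noteq> 0" using P_nz c by blast
    then show "countable {t. poly (P c) t = 0}" by (intro countable_finite poly_roots_finite)
  qed
  then obtain t where t: "t \<notin> (\<Union>c\<in>Cs - {\<lambda>_. 0}. {t. poly (P c) t = 0})"
    using uncountable_UNIV_real by (metis UNIV_I countable_subset subsetI)
  have "alg_indep (insert j I) (x(j := t))" unfolding alg_indep_def
  proof (intro allI impI)
    fix c :: "('a \<Rightarrow> nat) \<Rightarrow> rat" and m
    assume "finite {m. c m \<noteq> 0}" "\<forall>m. c m \<noteq> 0 \<longrightarrow> (\<forall>i. i \<notin> insert j I \<longrightarrow> m i = 0)"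
      and sum: "(\<Sum>m | c m \<noteq> 0. of_rat (c m) * (\<Prod>i\<in>insert j I. (x(j := t)) i ^ m i)) = 0"
    then have c: "c \<in> Cs" by (simp add: Cs_def)
    have "(\<Prod>i\<in>I. (x(j := t)) i ^ m i) = (\<Prod>i\<in>I. x i ^ m i)" for m :: "'a \<Rightarrow> nat"
      using insert.hyps by (intro prod.cong) auto
    then have "poly (P c) t = 0"
      using sum insert.hyps by (simp add: P_def poly_sum poly_monom mult_ac)
    then show "c m = 0" using t c by auto
  qed
  then show ?case by blast
qed

text \<open>Gaussian elimination without division: \<open>h\<close> is the product of the pivots.\<close>

lemma ratpoly_family_indep_witness:
  fixes a :: "'e \<Rightarrow> 'j \<Rightarrow> ('i \<Rightarrow> real) \<Rightarrow> real"
  assumes "finite P" "\<And>e j. e \<in> P \<Longrightarrow> a e j \<in> ratpoly I"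
    and "\<forall>c. (\<forall>j. (\<Sum>e\<in>P. c e * a e j q) = 0) \<longrightarrow> (\<forall>e\<in>P. c e = 0)"
  shows "\<exists>h\<in>ratpoly I. h q \<noteq> 0 \<and> (\<forall>m. h m \<noteq> 0 \<longrightarrow>
    (\<forall>c. (\<forall>j. (\<Sum>e\<in>P. c e * a e j m) = 0) \<longrightarrow> (\<forall>e\<in>P. c e = 0)))"
  using assms
proof (induction P arbitrary: a)
  case empty
  show ?case using ratpoly_1 by (intro bexI[of _ "\<lambda>_. 1"]) auto
next
  case (insert k P)
  have "\<exists>j. a k j q \<noteq> 0"
  proof (rule ccontr)
    assume "\<not> ?thesis"
    moreover have "(\<Sum>e\<in>P. (if e = k then 1 else 0) * a e j q) = 0" for j
      using insert.hyps by (intro sum.neutral) auto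
    ultimately have "\<forall>j. (\<Sum>e\<in>insert k P. (if e = k then 1 else 0) * a e j q) = 0"
      using insert.hyps by simp
    then have "\<forall>e\<in>insert k P. (if e = k then 1 else 0) = (0::real)"
      using insert.prems(2)[rule_format, of "\<lambda>e. if e = k then 1 else 0"] by blast
    then show False by simp
  qed
  then obtain j0 where j0: "a k j0 q \<noteq> 0" by blast
  define b where "b e j m = a k j0 m * a e j m - a e j0 m * a k j m" for e j m
  have b_sum: "(\<Sum>e\<in>P. c e * b e j m) =
      a k j0 m * (\<Sum>e\<in>P. c e * a e j m) - (\<Sum>e\<in>P. c e * a e j0 m) * a k j m" for c j m
    by (simp add: b_def right_diff_distrib sum_subtractf sum_distrib_left sum_distrib_right mult_ac)
  have b_ratpoly: "b e j \<in> ratpoly I" if "e \<in> P" for e j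
    unfolding b_def using insert.prems(1) that by (auto intro!: ratpoly_diff ratpoly.mult)
  have b_indep: "\<forall>c. (\<forall>j. (\<Sum>e\<in>P. c e * b e j q) = 0) \<longrightarrow> (\<forall>e\<in>P. c e = 0)"
  proof (intro allI impI)
    fix c assume c: "\<forall>j. (\<Sum>e\<in>P. c e * b e j q) = 0"
    define c' where "c' = (\<lambda>e. if e = k then - (\<Sum>e\<in>P. c e * a e j0 q) else a k j0 q * c e)"
    have "(\<Sum>e\<in>insert k P. c' e * a e j q) = (\<Sum>e\<in>P. c e * b e j q)" for j
    proof -
      have "(\<Sum>e\<in>P. c' e * a e j q) = a k j0 q * (\<Sum>e\<in>P. c e * a e j q)"
        unfolding sum_distrib_left using insert.hyps by (intro sum.cong) (auto simp: c'_def)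
      then show ?thesis unfolding b_sum using insert.hyps by (simp add: c'_def)
    qed
    then have "\<forall>e\<in>insert k P. c' e = 0" using insert.prems(2) c by metis
    then show "\<forall>e\<in>P. c e = 0"
      using j0 insert.hyps unfolding c'_def by (metis insertCI mult_eq_0_iff)
  qed
  obtain h where h: "h \<in> ratpoly I" "h q \<noteq> 0"
    "\<And>m c. h m \<noteq> 0 \<Longrightarrow> \<forall>j. (\<Sum>e\<in>P. c e * b e j m) = 0 \<Longrightarrow> \<forall>e\<in>P. c e = 0"
    using insert.IH[OF b_ratpoly b_indep] by blast
  show ?case
  proof (intro bexI[of _ "\<lambda>m. h m * a k j0 m"] conjI allI impI)
    show "(\<lambda>m. h m * a k j0 m) \<in> ratpoly I"
      using h(1) insert.prems(1) by (auto intro: ratpoly.mult)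
    show "h q * a k j0 q \<noteq> 0" using h(2) j0 by simp
    fix m c assume m: "h m * a k j0 m \<noteq> 0" and c: "\<forall>j. (\<Sum>e\<in>insert k P. c e * a e j m) = 0"
    have eq: "(\<Sum>e\<in>P. c e * a e j m) = - (c k * a k j m)" for j
      using c insert.hyps by (simp add: eq_neg_iff_add_eq_0 add.commute)
    have "h m \<noteq> 0" using m by simp
    moreover have "\<forall>j. (\<Sum>e\<in>P. c e * b e j m) = 0" unfolding b_sum eq by simp
    ultimately have z: "\<forall>e\<in>P. c e = 0" by (rule h(3))
    then have "c k * a k j0 m = 0" using eq[of j0] by simp
    then show "\<forall>e\<in>insert k P. c e = 0" using z m by simp
  qed
qed

subsection \<open>Random insertion orders\<close>

text \<open>What the averaging argument uses of the generic rigidity matroid: \<open>adj\<close> is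
  adjacency in a closed graph and \<open>r W\<close> the rank of its part on \<open>W\<close>. The
  last three assumptions are 0-extension, 1-extension and the merging of two cliques along
  \<open>d\<close> common vertices.\<close>

locale rigidity_closure =
  fixes V :: "'v set" and adj :: "'v \<Rightarrow> 'v \<Rightarrow> bool" and d :: nat and r :: "'v set \<Rightarrow> nat"
  assumes finite_V: "finite V"
    and adj_sym: "adj u v \<Longrightarrow> adj v u"
    and adj_irrefl: "\<not> adj v v"
    and adj_in_V: "adj u v \<Longrightarrow> u \<in> V"
    and rank_add_vertex: "\<lbrakk>W \<subseteq> V; v \<in> W\<rbrakk> \<Longrightarrow> r (W - {v}) + min d (card {u \<in> W. adj v u}) \<le> r W"
    and rank_add_vertex_nonclique:
      "\<lbrakk>W \<subseteq> V; v \<in> W; d < card {u \<in> W. adj v u}; x \<in> W; y \<in> W; adj v x; adj v y; x \<noteq> y; \<not> adj x y\<rbrakk>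
        \<Longrightarrow> r (W - {v}) + d + 1 \<le> r W"
    and merge: "\<lbrakk>S \<subseteq> V; card S = d; \<And>s t. \<lbrakk>s \<in> S; t \<in> S; s \<noteq> t\<rbrakk> \<Longrightarrow> adj s t; x \<in> V; y \<in> V; x \<noteq> y;
        \<And>s. s \<in> S \<Longrightarrow> adj x s \<and> adj y s\<rbrakk> \<Longrightarrow> adj x y"
begin

definition clique :: "'v set \<Rightarrow> bool" where
  "clique S \<longleftrightarrow> (\<forall>s\<in>S. \<forall>t\<in>S. s \<noteq> t \<longrightarrow> adj s t)"

definition nbrs :: "'v set \<Rightarrow> 'v \<Rightarrow> 'v set" where
  "nbrs W v = {u \<in> W. adj v u}"

definition gain :: "'v set \<Rightarrow> nat" where
  "gain N = (if card N \<le> d then card N else if clique N then d else d + 1)"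

text \<open>A lower bound for the expected \<open>gain\<close> of a vertex with neighbourhood \<open>N\<close> when
  the vertices are inserted in a uniformly random order.\<close>

definition pot :: "'v set \<Rightarrow> real" where
  "pot N = (if card N \<le> d then card N / 2
    else if clique N then d - d * (d + 1) / 2 / (card N + 1)
    else d + 1 / 2 - d * (d + 1) / 2 / card N)"

lemma clique_subset: "clique T \<Longrightarrow> S \<subseteq> T \<Longrightarrow> clique S"
  unfolding clique_def by blast

lemma merge_large:
  assumes "S \<subseteq> V" "clique S" "d \<le> card S" "x \<in> V" "y \<in> V" "x \<noteq> y"
    and "\<And>s. s \<in> S \<Longrightarrow> adj x s \<and> adj y s"
  shows "adj x y"
proof -
  obtain T where T: "T \<subseteq> S" "card T = d" using obtain_subset_with_card_n[OF assms(3)] by blast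
  show ?thesis
  proof (rule merge[of T])
    show "adj s t" if "s \<in> T" "t \<in> T" "s \<noteq> t" for s t
      using assms(2) T(1) that unfolding clique_def by blast
  qed (use T assms in auto)
qed

text \<open>If \<open>a\<close> and \<open>b\<close> differed, \<open>v\<close> together with
  \<open>N - {a, b}\<close> would be a clique of at least \<open>d\<close> vertices joined to both,
  so merging would make them adjacent. Every other pair in \<open>N\<close> avoids \<open>a\<close>
  or \<open>b\<close>, hence \<open>N\<close> would be a clique. Including \<open>v\<close> is what
  makes \<open>d\<close> vertices available even for \<open>card N = d + 1\<close>.\<close>

lemma clique_minus_unique:
  assumes v: "v \<in> V" "N \<subseteq> V" "\<forall>u\<in>N. adj v u" and "d < card N" "\<not> clique N"
    and "a \<in> N" "b \<in> N" "clique (N - {a})" "clique (N - {b})"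
  shows "a = b"
proof (rule ccontr)
  assume ab: "a \<noteq> b"
  let ?S = "insert v (N - {a, b})"
  have fin: "finite N" using assms(2) finite_V finite_subset by blast
  have vN: "v \<notin> N" using v adj_irrefl by blast
  have "card (N - {a, b}) = card N - 2" using ab assms fin by (simp add: card_Diff_subset)
  moreover have "card ?S = Suc (card (N - {a, b}))" using fin vN by simp
  ultimately have "d \<le> card ?S" using assms(4) by linarith
  moreover have "clique ?S"
    unfolding clique_def
  proof (intro ballI impI)
    fix s t assume "s \<in> ?S" "t \<in> ?S" "s \<noteq> t"
    then consider "s = v" "t \<in> N" | "t = v" "s \<in> N" | "s \<in> N - {a}" "t \<in> N - {a}" by blast
    then show "adj s t"
    proof cases
      case 3
      then show ?thesis using assms(8) \<open>s \<noteq> t\<close> unfolding clique_def by blast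
    qed (use assms(3) adj_sym in auto)
  qed
  moreover have "adj a s \<and> adj b s" if s: "s \<in> ?S" for s
  proof (cases "s = v")
    case True
    then show ?thesis using assms(3,6,7) adj_sym by blast
  next
    case False
    then have "s \<in> N - {b}" "s \<in> N - {a}" "s \<noteq> a" "s \<noteq> b" using s by auto
    moreover have "a \<in> N - {b}" "b \<in> N - {a}" using assms(6,7) ab by auto
    ultimately show ?thesis using assms(8,9) unfolding clique_def by metis
  qed
  moreover have "?S \<subseteq> V" "a \<in> V" "b \<in> V" using assms by auto
  ultimately have adj: "adj a b" using merge_large[of ?S a b] ab by simp
  have "clique N" unfolding clique_def
  proof (intro ballI impI)
    fix s t assume st: "s \<in> N" "t \<in> N" "s \<noteq> t"
    then consider "s \<in> N - {a}" "t \<in> N - {a}" | "s \<in> N - {b}" "t \<in> N - {b}" | "s = a" "t = b" | "s = b" "t = a"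
      using ab by blast
    then show "adj s t"
    proof cases
      case 1
      then show ?thesis using assms(8) st(3) unfolding clique_def by simp
    next
      case 2
      then show ?thesis using assms(9) st(3) unfolding clique_def by simp
    qed (use adj adj_sym in auto)
  qed
  then show False using assms(5) by simp
qed

text \<open>Among \<open>v\<close> and its \<open>D\<close> neighbours each is equally likely to
  come last: either \<open>v\<close> does and earns \<open>gain N\<close>, or some \<open>w\<close>
  does and \<open>N - {w}\<close> remains. With C = d (d + 1) / 2, the first two values of
  \<open>pot\<close> are the mean of \<open>min d k\<close> over uniform k in {0..D}. The third
  exceeds the second by 1 / 2 - C / (D (D + 1)), the probability that more than \<open>d\<close>
  neighbours precede \<open>v\<close> and a fixed one is among them; the extremal case is a
  neighbour \<open>a\<close> for which \<open>N - {a}\<close> is a clique.\<close>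

lemma pot_step:
  assumes "v \<in> V" "N \<subseteq> V" "\<forall>u\<in>N. adj v u" "d > 0"
  shows "(real (card N) + 1) * pot N \<le> gain N + (\<Sum>w\<in>N. pot (N - {w}))"
proof -
  have fin: "finite N" using assms(2) finite_V finite_subset by blast
  define D where "D = card N"
  define C :: real where "C = d * (d + 1) / 2"
  have card_minus: "card (N - {w}) = D - 1" if "w \<in> N" for w
    using that fin by (simp add: D_def)
  consider "D \<le> d" | "d < D" "clique N" | "d < D" "\<not> clique N" by linarith
  then show ?thesis
  proof cases
    case 1
    have "(\<Sum>w\<in>N. pot (N - {w})) = (\<Sum>w\<in>N. real (D - 1) / 2)"
      using 1 by (intro sum.cong) (auto simp: pot_def card_minus simp del: card_Diff_insert)
    also have "\<dots> = D * (real (D - 1) / 2)" by (simp add: D_def)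
    finally show ?thesis using 1
      by (cases D) (auto simp: pot_def gain_def D_def[symmetric] field_simps)
  next
    case 2
    have "pot (N - {w}) = d - C / D" if w: "w \<in> N" for w
    proof (cases "D - 1 \<le> d")
      case True
      then have "D = d + 1" using 2 by simp
      then show ?thesis using w card_minus[OF w] by (simp add: pot_def C_def field_simps)
    next
      case False
      have "clique (N - {w})" using 2 clique_subset by blast
      moreover have "real (D - 1) + 1 = D" using 2 by simp
      ultimately show ?thesis using False card_minus[OF w]
        by (simp only: pot_def C_def) simp
    qed
    then have "(\<Sum>w\<in>N. pot (N - {w})) = D * (d - C / D)" by (simp add: D_def)
    also have "\<dots> = D * d - C" using 2 by (simp add: field_simps)
    finally have "(\<Sum>w\<in>N. pot (N - {w})) = D * d - C" .
    moreover have "pot N = d - C / (D + 1)" using 2 by (simp add: pot_def C_def D_def)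
    then have "(real D + 1) * pot N = (real D + 1) * d - C" by (simp add: field_simps)
    moreover have "gain N = d" using 2 by (simp add: gain_def D_def)
    ultimately show ?thesis by (simp add: D_def[symmetric] distrib_right)
  next
    case 3
    then have D: "real D > 1" using assms(4) by simp
    let ?lo = "d - C / D" and ?hi = "d + 1 / 2 - C / (real D - 1)"
    have DD: "real (D - 1) = real D - 1" using D by simp
    \<comment> \<open>The two values differ by 1 / 2 - C / (D (D - 1)), which is nonnegative because
      \<open>d < D\<close>.\<close>
    have lo: "?lo \<le> ?hi"
    proof -
      have "real d \<le> real D - 1" using 3 by linarith
      moreover have "real (d + 1) \<le> D" using 3 by linarith
      ultimately have "real d * real (d + 1) \<le> (real D - 1) * real D"
        using D by (intro mult_mono) auto
      moreover have "2 * C = real d * real (d + 1)" by (simp add: C_def algebra_simps)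
      ultimately have "2 * C \<le> (real D - 1) * real D" by simp
      then have "C / ((real D - 1) * real D) \<le> 1 / 2" using D by (simp add: divide_le_eq)
      moreover have "C / (real D - 1) - C / D = C / ((real D - 1) * real D)"
        using D by (simp add: field_simps)
      ultimately show ?thesis by linarith
    qed
    \<comment> \<open>For \<open>D = d + 1\<close> the set \<open>N - {w}\<close> has only
      \<open>d\<close> elements; its value \<open>d / 2\<close> then agrees with both
      \<open>?lo\<close> and \<open>?hi\<close>.\<close>
    have eq: "pot (N - {w}) = (if clique (N - {w}) then ?lo else ?hi) \<or> D = d + 1 \<and> pot (N - {w}) = ?lo \<and> ?lo = ?hi"
      if w: "w \<in> N" for w
    proof (cases "D - 1 \<le> d")
      case True
      then have "D = d + 1" using 3 by simp
      then show ?thesis using w card_minus[OF w] assms(4) by (simp add: pot_def C_def field_simps)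
    next
      case False
      have "real (D - 1) + 1 = D" using 3 by simp
      then show ?thesis using False card_minus[OF w]
        by (simp only: pot_def C_def) (simp add: DD)
    qed
    have hi: "pot (N - {w}) \<ge> ?hi" if "w \<in> N" "\<not> clique (N - {w})" for w
      using eq[OF that(1)] that(2) by auto
    have lo': "pot (N - {w}) \<ge> ?lo" if "w \<in> N" for w
      using eq[OF that(1)] lo by (auto split: if_splits)
    \<comment> \<open>At most one deletion can leave a clique, and only that one can fall to the
      lower value.\<close>
    have sum_ge: "?lo + (real D - 1) * ?hi \<le> (\<Sum>w\<in>N. pot (N - {w}))"
    proof (cases "\<exists>a\<in>N. clique (N - {a})")
      case True
      then obtain a where a: "a \<in> N" "clique (N - {a})" by blast
      have "(\<Sum>w\<in>N. pot (N - {w})) = pot (N - {a}) + (\<Sum>w\<in>N - {a}. pot (N - {w}))"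
        using a fin by (simp add: sum.remove)
      moreover have "(\<Sum>w\<in>N - {a}. pot (N - {w})) \<ge> (\<Sum>w\<in>N - {a}. ?hi)"
      proof (rule sum_mono)
        fix w assume w: "w \<in> N - {a}"
        have "\<not> clique (N - {w})"
          using clique_minus_unique[OF assms(1-3) _ 3(2) a(1) _ a(2)] w 3 by (auto simp: D_def)
        then show "?hi \<le> pot (N - {w})" using hi w by simp
      qed
      moreover have "(\<Sum>w\<in>N - {a}. ?hi) = (real D - 1) * ?hi"
        using a card_minus[OF a(1)] DD by simp
      ultimately show ?thesis using lo'[OF a(1)] by linarith
    next
      case False
      have "real D * h = h + (real D - 1) * h" for h by (simp add: left_diff_distrib)
      then have "?lo + (real D - 1) * ?hi \<le> real D * ?hi"
        using add_right_mono[OF lo] by metis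
      also have "\<dots> = (\<Sum>w\<in>N. ?hi)" by (simp add: D_def)
      also have "\<dots> \<le> (\<Sum>w\<in>N. pot (N - {w}))" using False hi by (intro sum_mono) auto
      finally show ?thesis .
    qed
    have "pot N = d + 1 / 2 - C / D" using 3 by (simp add: pot_def C_def D_def)
    moreover have "\<not> card N \<le> d" using 3(1) unfolding D_def by linarith
    then have "gain N = d + 1" using 3(2) unfolding gain_def by presburger
    moreover have "(real D + 1) * (real d + 1 / 2 - C / real D) = real d + 1 + (?lo + (real D - 1) * ?hi)"
    proof -
      define z where "z = real d + 1 / 2"
      have q: "(real D - 1) * (C / (real D - 1)) = C" using D by simp
      have 1: "(real D - 1) * (z - C / (real D - 1)) = real D * z - z - C"
        unfolding right_diff_distrib q by (simp add: left_diff_distrib)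
      have 2: "(real D + 1) * (z - C / real D) = real D * z + z - C - C / real D"
        using D by (simp add: right_diff_distrib distrib_right add_divide_distrib)
      show ?thesis using 1 2 unfolding z_def by linarith
    qed
    ultimately show ?thesis using sum_ge by (simp add: D_def[symmetric])
  qed
qed

lemma rank_gain:
  assumes "W \<subseteq> V" "v \<in> W"
  shows "r (W - {v}) + gain (nbrs W v) \<le> r W"
proof (cases "d < card (nbrs W v) \<and> \<not> clique (nbrs W v)")
  case True
  then obtain x y where "x \<in> nbrs W v" "y \<in> nbrs W v" "x \<noteq> y" "\<not> adj x y"
    unfolding clique_def by blast
  then show ?thesis
    using rank_add_vertex_nonclique[OF assms, of x y] True by (simp add: nbrs_def gain_def)
next
  case False
  then show ?thesis
    using rank_add_vertex[OF assms] by (auto simp: nbrs_def gain_def)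
qed

text \<open>The random order appears as an induction on \<open>W\<close>: averaging over the vertex
  inserted last replaces permutations. Summing \<open>rank_gain\<close> over all choices of that
  vertex gives \<open>card W\<close> times the claim.\<close>

lemma rank_ge_pot:
  assumes "W \<subseteq> V" "d > 0"
  shows "(\<Sum>v\<in>W. pot (nbrs W v)) \<le> r W"
proof -
  have "finite W" using assms finite_V finite_subset by blast
  then show ?thesis using assms(1)
  proof (induction W rule: finite_psubset_induct)
    case (psubset W)
    show ?case
    proof (cases "W = {}")
      case False
      define m where "m = card W"
      have m: "m > 0" using False psubset.hyps by (simp add: m_def card_gt_0_iff)
      have nbrs_minus: "nbrs (W - {w}) v = nbrs W v - {w}" for w v by (auto simp: nbrs_def)
      \<comment> \<open>Deleting a vertex outside \<open>?N\<close> leaves \<open>?N\<close>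
        unchanged, so the \<open>m - 1 - card ?N\<close> such vertices add equally to both sides of
        \<open>pot_step\<close>.\<close>
      have step: "m * pot (nbrs W v) \<le> gain (nbrs W v) + (\<Sum>w\<in>W - {v}. pot (nbrs W v - {w}))"
        if v: "v \<in> W" for v
      proof -
        let ?N = "nbrs W v"
        have sub: "?N \<subseteq> W - {v}" by (auto simp: nbrs_def adj_irrefl)
        have "(\<Sum>w\<in>W - {v}. pot (?N - {w})) =
            (\<Sum>w\<in>W - {v} - ?N. pot (?N - {w})) + (\<Sum>w\<in>?N. pot (?N - {w}))"
          using sub psubset.hyps by (intro sum.subset_diff) auto
        also have "(\<Sum>w\<in>W - {v} - ?N. pot (?N - {w})) = card (W - {v} - ?N) * pot ?N"
          by simp
        also have "card (W - {v} - ?N) = m - 1 - card ?N"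
          using sub v psubset.hyps by (simp add: card_Diff_subset finite_subset m_def)
        finally have "(\<Sum>w\<in>W - {v}. pot (?N - {w})) =
            real (m - 1 - card ?N) * pot ?N + (\<Sum>w\<in>?N. pot (?N - {w}))" .
        moreover have "card ?N \<le> m - 1"
          using card_mono[OF _ sub] v psubset.hyps by (simp add: m_def)
        then have "real m = real (m - 1 - card ?N) + (real (card ?N) + 1)" using m by simp
        then have "m * pot ?N = (real (m - 1 - card ?N) + (real (card ?N) + 1)) * pot ?N"
          by (rule arg_cong)
        then have "m * pot ?N = real (m - 1 - card ?N) * pot ?N + (real (card ?N) + 1) * pot ?N"
          by (simp only: distrib_right)
        moreover have "(real (card ?N) + 1) * pot ?N \<le> gain ?N + (\<Sum>w\<in>?N. pot (?N - {w}))"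
        proof (rule pot_step)
          show "v \<in> V" using v psubset.prems by blast
          show "?N \<subseteq> V" using psubset.prems unfolding nbrs_def by blast
          show "\<forall>u\<in>?N. adj v u" unfolding nbrs_def by blast
        qed (rule assms(2))
        ultimately show ?thesis by linarith
      qed
      have "m * (\<Sum>v\<in>W. pot (nbrs W v)) \<le>
          (\<Sum>v\<in>W. gain (nbrs W v) + (\<Sum>w\<in>W - {v}. pot (nbrs W v - {w})))"
        unfolding sum_distrib_left of_nat_sum using step by (intro sum_mono) simp
      also have "\<dots> = (\<Sum>v\<in>W. real (gain (nbrs W v))) + (\<Sum>v\<in>W. \<Sum>w\<in>W - {v}. pot (nbrs W v - {w}))"
        by (simp add: sum.distrib)
      also have "(\<Sum>v\<in>W. \<Sum>w\<in>W - {v}. pot (nbrs W v - {w})) =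
          (\<Sum>v\<in>W. \<Sum>w | w \<in> W \<and> v \<noteq> w. pot (nbrs W v - {w}))"
        by (intro sum.cong) auto
      \<comment> \<open>Exchanging the sums groups the terms by the deleted vertex \<open>w\<close>,
        where the induction hypothesis for \<open>W - {w}\<close> applies.\<close>
      also have "\<dots> = (\<Sum>w\<in>W. \<Sum>v | v \<in> W \<and> v \<noteq> w. pot (nbrs W v - {w}))"
        using psubset.hyps by (intro sum.swap_restrict) auto
      also have "\<dots> = (\<Sum>w\<in>W. \<Sum>v\<in>W - {w}. pot (nbrs (W - {w}) v))"
        unfolding nbrs_minus by (intro sum.cong) auto
      also have "\<dots> \<le> (\<Sum>w\<in>W. real (r (W - {w})))"
        using psubset.IH psubset.prems by (intro sum_mono) blast
      also have "(\<Sum>v\<in>W. real (gain (nbrs W v))) + \<dots> = (\<Sum>v\<in>W. real (r (W - {v}) + gain (nbrs W v)))"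
        by (simp add: sum.distrib)
      also have "\<dots> \<le> (\<Sum>v\<in>W. real (r W))"
        by (intro sum_mono) (simp only: of_nat_le_iff rank_gain[OF psubset.prems])
      also have "\<dots> = m * real (r W)" by (simp add: m_def)
      finally show ?thesis using m by simp
    qed simp
  qed
qed

theorem rank_ge_of_ore:
  assumes d: "d > 0" and n: "n = card V" "d * (d + 2) \<le> n"
    and ore: "\<And>u v. \<lbrakk>u \<in> V; v \<in> V; u \<noteq> v; \<not> adj u v\<rbrakk> \<Longrightarrow> n + d - 2 \<le> card (nbrs V u) + card (nbrs V v)"
    and not_complete: "\<not> clique V"
  shows "d * n - d * (d + 1) / 2 \<le> r V"
proof -
  let ?D = "\<lambda>v. card (nbrs V v)"
  have fin: "finite (nbrs V v)" for v using finite_V by (simp add: nbrs_def)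
  have n_ge: "d + 2 \<le> n"
  proof -
    have "d + 2 \<le> d * (d + 2)" using d by (cases d) auto
    then show ?thesis using n(2) by (rule order_trans)
  qed
  have nbrs_le: "?D v \<le> n - 1" if "v \<in> V" for v
  proof -
    have "nbrs V v \<subseteq> V - {v}" by (auto simp: nbrs_def adj_irrefl)
    from card_mono[OF _ this] show ?thesis using finite_V that n by simp
  qed
  \<comment> \<open>The two neighbourhoods lie among \<open>n - 2\<close> vertices and have at least
    \<open>n + d - 2\<close> elements in total.\<close>
  have common: "d \<le> card (nbrs V u \<inter> nbrs V v)"
    if uv: "u \<in> V" "v \<in> V" "u \<noteq> v" "\<not> adj u v" for u v
  proof -
    have "nbrs V u \<union> nbrs V v \<subseteq> V - {u, v}"
      using uv adj_irrefl adj_sym by (auto simp: nbrs_def)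
    from card_mono[OF _ this] have "card (nbrs V u \<union> nbrs V v) \<le> n - 2"
      using finite_V uv n by (simp add: card_Diff_subset)
    then show ?thesis using ore[OF uv] card_Un_Int[OF fin fin, of u v] n_ge by linarith
  qed
  have nonadjacent: "\<exists>u\<in>V. u \<noteq> v \<and> \<not> adj v u" if v: "v \<in> V" "clique (nbrs V v) \<or> ?D v \<le> d" for v
  proof (rule ccontr)
    assume H: "\<not> ?thesis"
    then have eq: "nbrs V v = V - {v}" by (auto simp: nbrs_def adj_irrefl)
    then have "card (nbrs V v) = n - 1" using v(1) n(1) finite_V by simp
    then have "clique (nbrs V v)" using v(2) n_ge by linarith
    have "clique V" unfolding clique_def
    proof (intro ballI impI)
      fix s t assume st: "s \<in> V" "t \<in> V" "s \<noteq> t"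
      then consider "s = v" | "t = v" | "s \<in> nbrs V v" "t \<in> nbrs V v" using eq by blast
      then show "adj s t"
      proof cases
        case 1
        then show ?thesis using H st by metis
      next
        case 2
        then show ?thesis using H st adj_sym by metis
      next
        case 3
        then show ?thesis using \<open>clique (nbrs V v)\<close> st(3) unfolding clique_def by blast
      qed
    qed
    then show False using not_complete by simp
  qed
  \<comment> \<open>If \<open>nbrs V v\<close> were a clique, a non-neighbour \<open>u\<close> would
    share with \<open>v\<close> a clique of at least \<open>d\<close> vertices, and merging would
    make the two adjacent.\<close>
  have nonclique: "\<not> clique (nbrs V v)" if v: "v \<in> V" for v
  proof
    assume cl: "clique (nbrs V v)"
    then obtain u where u: "u \<in> V" "u \<noteq> v" "\<not> adj v u" using nonadjacent v by blast
    have "adj v u"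
    proof (rule merge_large[of "nbrs V v \<inter> nbrs V u"])
      show "clique (nbrs V v \<inter> nbrs V u)" using cl clique_subset by blast
      show "d \<le> card (nbrs V v \<inter> nbrs V u)" using common u v by metis
      show "nbrs V v \<inter> nbrs V u \<subseteq> V" unfolding nbrs_def by blast
      show "adj v s \<and> adj u s" if "s \<in> nbrs V v \<inter> nbrs V u" for s
        using that unfolding nbrs_def by blast
    qed (use u v in auto)
    then show False using u by simp
  qed
  \<comment> \<open>If \<open>v\<close> had at most \<open>d\<close> neighbours, the degree
    condition would force each non-neighbour to be adjacent to all vertices but \<open>v\<close>.
    The non-neighbours would form a clique of at least \<open>d\<close> vertices joined to all
    neighbours of \<open>v\<close>, and merging would make the latter a clique.\<close>
  have deg: "d < ?D v" if v: "v \<in> V" for v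
  proof (rule ccontr)
    assume le: "\<not> d < ?D v"
    obtain x y where xy: "x \<in> nbrs V v" "y \<in> nbrs V v" "x \<noteq> y" "\<not> adj x y"
      using nonclique[OF v] unfolding clique_def by blast
    let ?U = "V - nbrs V v - {v}"
    have full: "adj u w" if u: "u \<in> ?U" and w: "w \<in> V" "w \<noteq> u" "w \<noteq> v" for u w
    proof (rule ccontr)
      assume na: "\<not> adj u w"
      have uv: "u \<noteq> v" "u \<in> V" "\<not> adj v u" "\<not> adj u v" using u adj_sym by (auto simp: nbrs_def)
      have "nbrs V u \<subseteq> V - {u, v, w}" using na uv adj_irrefl by (auto simp: nbrs_def)
      from card_mono[OF _ this] have "?D u \<le> n - 3"
        using finite_V uv v w n by (simp add: card_Diff_subset)
      moreover have "n + d - 2 \<le> ?D v + ?D u" using ore[of v u] uv v by blast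
      ultimately show False using le n_ge d by linarith
    qed
    have "card ?U = n - ?D v - 1"
      using v n fin by (simp add: card_Diff_subset nbrs_def adj_irrefl)
    moreover have "2 * d + 1 \<le> n"
    proof -
      have "0 < d * d" using d by simp
      moreover have "d * d + 2 * d \<le> n" using n(2) by (simp add: distrib_left mult.commute)
      ultimately show ?thesis by linarith
    qed
    ultimately have "d \<le> card ?U" using le by linarith
    moreover have "clique ?U" unfolding clique_def using full by auto
    moreover have "adj x s \<and> adj y s" if "s \<in> ?U" for s
    proof -
      have "x \<in> V" "x \<noteq> s" "x \<noteq> v" "y \<in> V" "y \<noteq> s" "y \<noteq> v"
        using xy(1,2) that adj_irrefl by (auto simp: nbrs_def)
      then show ?thesis using full[OF that] adj_sym by blast
    qed
    ultimately have "adj x y" using merge_large[of ?U x y] xy by (auto simp: nbrs_def)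
    then show False using xy by simp
  qed
  have V_ne: "V \<noteq> {}" using not_complete by (auto simp: clique_def)
  define C :: real where "C = d * (d + 1) / 2"
  have C: "C > 0" using d by (simp add: C_def add_pos_nonneg)
  obtain v0 where v0: "v0 \<in> V" "\<And>v. v \<in> V \<Longrightarrow> ?D v0 \<le> ?D v"
    using ex_has_least_nat[of "\<lambda>v. v \<in> V" _ ?D] V_ne by blast
  define \<delta> where "\<delta> = ?D v0"
  have \<delta>: "d < \<delta>" "\<delta> \<le> n - 1" using deg[OF v0(1)] nbrs_le[OF v0(1)] by (auto simp: \<delta>_def)
  \<comment> \<open>The closed neighbourhood of a vertex of minimum degree has \<delta> + 1 vertices
    of degree at least \<delta> and loses at most \<open>C + C / \<delta>\<close>. By the degree
    condition the other \<open>n - \<delta> - 1\<close> vertices have at least that degree, so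
    together they lose at most \<open>C\<close>.\<close>
  let ?A = "insert v0 (nbrs V v0)" and ?B = "V - nbrs V v0 - {v0}"
  have cardA: "card ?A = \<delta> + 1" using fin by (simp add: \<delta>_def nbrs_def adj_irrefl)
  have cardB: "card ?B = n - \<delta> - 1"
    using v0 n fin by (simp add: card_Diff_subset nbrs_def adj_irrefl \<delta>_def)
  have "(\<Sum>v\<in>V. C / ?D v) = (\<Sum>v\<in>?A \<union> ?B. C / ?D v)"
    using v0 by (intro sum.cong) (auto simp: nbrs_def)
  also have "\<dots> = (\<Sum>v\<in>?A. C / ?D v) + (\<Sum>v\<in>?B. C / ?D v)"
    using finite_V fin by (intro sum.union_disjoint) auto
  also have "(\<Sum>v\<in>?A. C / ?D v) \<le> (\<Sum>v\<in>?A. C / \<delta>)"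
  proof (rule sum_mono)
    fix v assume "v \<in> ?A"
    then have "\<delta> \<le> ?D v" using v0 by (auto simp: \<delta>_def nbrs_def)
    then show "C / ?D v \<le> C / \<delta>" using \<delta> C by (intro divide_left_mono) auto
  qed
  also have "\<dots> = C + C / \<delta>" using cardA \<delta> by (simp add: field_simps)
  also have "(\<Sum>v\<in>?B. C / ?D v) \<le> (\<Sum>v\<in>?B. C / (n - \<delta> - 1))"
  proof (rule sum_mono)
    fix v assume v: "v \<in> ?B"
    then have "n + d - 2 \<le> \<delta> + ?D v" using ore[of v0 v] v0 by (auto simp: \<delta>_def nbrs_def)
    moreover have "n - \<delta> - 1 > 0" using v cardB finite_V by (metis card_gt_0_iff empty_iff finite_Diff)
    ultimately have "n - \<delta> - 1 \<le> ?D v" "n - \<delta> - 1 > 0" using d by linarith+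
    then show "C / ?D v \<le> C / (n - \<delta> - 1)"
      using C by (intro divide_left_mono) auto
  qed
  also have "\<dots> \<le> C"
  proof -
    have "(\<Sum>v\<in>?B. C / (n - \<delta> - 1)) = real (card ?B) * (C / real (n - \<delta> - 1))"
      using \<delta> n_ge by simp
    also have "\<dots> \<le> C" using C by (simp add: cardB)
    finally show ?thesis .
  qed
  finally have sum_le: "(\<Sum>v\<in>V. C / ?D v) \<le> 2 * C + C / \<delta>" by simp
  have "C / \<delta> \<le> C / (d + 1)" using \<delta> C by (intro divide_left_mono) auto
  also have "\<dots> = d / 2" by (simp add: C_def field_simps)
  finally have "(\<Sum>v\<in>V. C / ?D v) \<le> C + n / 2"
  proof -
    assume "C / \<delta> \<le> d / 2"
    moreover have "real (d * (d + 2)) \<le> n" using n(2) by linarith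
    ultimately show ?thesis using sum_le by (simp add: C_def field_simps)
  qed
  moreover have "pot (nbrs V v) = d + 1 / 2 - C / ?D v" if "v \<in> V" for v
    using nonclique[OF that] deg[OF that] by (simp add: pot_def C_def)
  then have "(\<Sum>v\<in>V. pot (nbrs V v)) = n * (d + 1 / 2) - (\<Sum>v\<in>V. C / ?D v)"
    using n(1) by (simp add: sum_subtractf)
  ultimately show ?thesis
    using rank_ge_pot[OF order_refl d] by (simp add: C_def algebra_simps)
qed

end

subsection \<open>The rigidity matrix\<close>

text \<open>A row of the rigidity matrix. Pairs are ordered, but both orders give the same row and a
  pair \<open>(u, u)\<close> gives 0, so a set of pairs has the rank of the underlying edge
  set.\<close>

definition edge_row :: "nat \<Rightarrow> (nat \<Rightarrow> nat \<Rightarrow> real) \<Rightarrow> nat \<times> nat \<Rightarrow> nat \<times> nat \<Rightarrow> real" where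
  "edge_row d p = (\<lambda>(u, v) (w, i). if i < d then
      if w = u then p u i - p v i else if w = v then p v i - p u i else 0
    else 0)"

definition rk :: "nat \<Rightarrow> (nat \<Rightarrow> nat \<Rightarrow> real) \<Rightarrow> (nat \<times> nat) set \<Rightarrow> nat" where
  "rk d p P = fv.dim (edge_row d p ` P)"

lemma edge_row_sym: "edge_row d p (u, v) = edge_row d p (v, u)"
  by (auto simp: edge_row_def fun_eq_iff)

lemma edge_row_self: "edge_row d p (u, u) = 0"
  by (auto simp: edge_row_def fun_eq_iff)

lemma edge_row_cong: "\<lbrakk>p u = q u; p v = q v\<rbrakk> \<Longrightarrow> edge_row d p (u, v) = edge_row d q (u, v)"
  by (auto simp: edge_row_def fun_eq_iff)

text \<open>One polynomial \<open>h\<close> certifies the independence of the rows in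
  \<open>P\<close>. It cannot vanish at a generic placement, and along a motion it stays nonzero for
  a while by continuity; both uses occur below.\<close>

lemma rk_full_witness:
  assumes "P \<subseteq> {..<n} \<times> {..<n}" "rk d q P = card P"
  shows "\<exists>h\<in>ratpoly ({0..<n} \<times> {0..<d}). h (case_prod q) \<noteq> 0 \<and>
    (\<forall>m. h (case_prod m) \<noteq> 0 \<longrightarrow> rk d m P = card P)"
proof -
  have fin: "finite P" using assms(1) finite_subset by blast
  define a where "a = (\<lambda>e j (x :: nat \<times> nat \<Rightarrow> real). edge_row d (curry x) e j)"
  have a_case: "a e j (case_prod m) = edge_row d m e j" for e j m by (simp add: a_def)
  have "a e j \<in> ratpoly ({0..<n} \<times> {0..<d})" if "e \<in> P" for e j
  proof -
    obtain u v where e: "e = (u, v)" by (cases e)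
    then have uv: "u < n" "v < n" using assms(1) that by auto
    obtain w i where j: "j = (w, i)" by (cases j)
    have "(\<lambda>x. x (u', i)) \<in> ratpoly ({0..<n} \<times> {0..<d})" if "u' < n" "i < d" for u'
      using that by (intro ratpoly.var) simp
    then show ?thesis using e uv
      by (cases "i < d"; cases "w = u"; cases "w = v")
        (simp_all add: a_def edge_row_def j ratpoly_0 ratpoly_diff)
  qed
  moreover have "\<forall>c. (\<forall>j. (\<Sum>e\<in>P. c e * a e j (case_prod q)) = 0) \<longrightarrow> (\<forall>e\<in>P. c e = 0)"
    unfolding a_case using assms(2) fv_indep_iff[OF fin, of "edge_row d q"] by (simp add: rk_def)
  ultimately have "\<exists>h\<in>ratpoly ({0..<n} \<times> {0..<d}). h (case_prod q) \<noteq> 0 \<and> (\<forall>x. h x \<noteq> 0 \<longrightarrow>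
      (\<forall>c. (\<forall>j. (\<Sum>e\<in>P. c e * a e j x) = 0) \<longrightarrow> (\<forall>e\<in>P. c e = 0)))"
    by (intro ratpoly_family_indep_witness[OF fin])
  then obtain h where h: "h \<in> ratpoly ({0..<n} \<times> {0..<d})" "h (case_prod q) \<noteq> 0"
    "\<forall>x. h x \<noteq> 0 \<longrightarrow> (\<forall>c. (\<forall>j. (\<Sum>e\<in>P. c e * a e j x) = 0) \<longrightarrow> (\<forall>e\<in>P. c e = 0))"
    by (elim bexE conjE)
  have "rk d m P = card P" if "h (case_prod m) \<noteq> 0" for m
    using h(3)[THEN spec, THEN mp, OF that] fv_indep_iff[OF fin, of "edge_row d m"]
    unfolding a_case rk_def by simp
  then show ?thesis using h(1,2) by auto
qed

lemma rk_mono: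
  assumes "finite Q" "edge_row d p ` P \<subseteq> fv.span (edge_row d p ` Q)"
  shows "rk d p P \<le> rk d p Q"
  unfolding rk_def using assms by (intro fv.dim_mono_finite) auto

text \<open>Rows independent at \<open>q\<close> stay independent at the generic \<open>p\<close>,
  since their certificate is nonzero at \<open>q\<close> and hence at \<open>p\<close>.\<close>

lemma rk_le_generic:
  assumes "generic n d p" "P \<subseteq> {..<n} \<times> {..<n}"
  shows "rk d q P \<le> rk d p P"
proof -
  have fin: "finite P" using assms(2) finite_subset by blast
  obtain B where B: "B \<subseteq> P" "card B = rk d q P" "rk d q B = card B"
    using fv.obtain_indep_subfamily[OF fin, of "edge_row d q"] unfolding rk_def by metis
  obtain h where h: "h \<in> ratpoly ({0..<n} \<times> {0..<d})" "h (case_prod q) \<noteq> 0"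
    "\<forall>m. h (case_prod m) \<noteq> 0 \<longrightarrow> rk d m B = card B"
    using rk_full_witness[OF order_trans[OF B(1) assms(2)], of d q] B(3) by blast
  have "alg_indep ({0..<n} \<times> {0..<d}) (case_prod p)"
    using assms(1) unfolding generic_def .
  from ratpoly_nonzero_at_alg_indep[where f = h, OF _ h(1) this h(2)] have "h (case_prod p) \<noteq> 0" by simp
  then have "card B = rk d p B" using h(3) by simp
  also have "\<dots> \<le> rk d p P"
    using B(1) fin by (intro rk_mono) (auto intro: fv.span_base)
  finally show ?thesis using B(2) by simp
qed

section \<open>Affine independence and dependencies among rows\<close>

definition aff_indep :: "nat \<Rightarrow> (nat \<Rightarrow> nat \<Rightarrow> real) \<Rightarrow> nat set \<Rightarrow> bool" where
  "aff_indep d p A \<longleftrightarrow>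
    (\<forall>c. (\<forall>i<d. (\<Sum>u\<in>A. c u * p u i) = 0) \<longrightarrow> (\<Sum>u\<in>A. c u) = 0 \<longrightarrow> (\<forall>u\<in>A. c u = 0))"

lemma generic_aff_indep:
  assumes "generic n d p" "A \<subseteq> {..<n}" "card A \<le> d + 1"
  shows "aff_indep d p A"
proof -
  let ?I = "{0..<n} \<times> {0..<d}"
  have fin: "finite A" using assms(2) finite_subset by blast
  \<comment> \<open>From index \<open>d\<close> on the entry is 1: linear independence of the points
    extended by a 1 is affine independence.\<close>
  define a where "a = (\<lambda>u i (x :: nat \<times> nat \<Rightarrow> real). if i < d then x (u, i) else 1)"
  obtain f where f: "bij_betw f A {0..<card A}" using ex_bij_betw_finite_nat[OF fin] by blast
  \<comment> \<open>The special placement: points numbered below \<open>d\<close> become unit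
    vectors, and the one numbered \<open>d\<close>, if any, becomes the origin.\<close>
  define q where "q = (\<lambda>(u, i). if f u = i then 1 else 0 :: real)"
  have "a u i \<in> ratpoly ?I" if "u \<in> A" for u i
    using that assms(2) by (cases "i < d") (auto simp: a_def ratpoly_1 intro!: ratpoly.var)
  moreover have "\<forall>c. (\<forall>i. (\<Sum>u\<in>A. c u * a u i q) = 0) \<longrightarrow> (\<forall>u\<in>A. c u = 0)"
  proof (intro allI impI)
    fix c assume c: "\<forall>i. (\<Sum>u\<in>A. c u * a u i q) = 0"
    have small: "c u = 0" if u: "u \<in> A" "f u < d" for u
    proof -
      have "(\<Sum>v\<in>A. c v * a v (f u) q) = (\<Sum>v\<in>A. if v = u then c v else 0)"
        using bij_betw_imp_inj_on[OF f] u by (intro sum.cong) (auto simp: a_def q_def inj_on_eq_iff)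
      also have "\<dots> = c u" using u fin by simp
      finally show ?thesis using c by simp
    qed
    show "\<forall>u\<in>A. c u = 0"
    proof
      fix u assume u: "u \<in> A"
      show "c u = 0"
      proof (cases "f u < d")
        case False
        have others: "c v = 0" if v: "v \<in> A - {u}" for v
        proof -
          have "f v \<in> {0..<card A}" "f u \<in> {0..<card A}"
            using bij_betw_apply[OF f] u v by blast+
          moreover have "f v \<noteq> f u"
            using bij_betw_imp_inj_on[OF f] u v by (metis Diff_iff inj_on_eq_iff singletonI)
          ultimately have "f v < d" using False assms(3) by simp
          then show ?thesis using small v by blast
        qed
        have "0 = (\<Sum>v\<in>A. c v)" using c[rule_format, of d] by (simp add: a_def)
        also have "\<dots> = c u" using sum.remove[OF fin u, of c] others by simp
        finally show ?thesis by simp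
      qed (use small u in simp)
    qed
  qed
  ultimately have "\<exists>h\<in>ratpoly ?I. h q \<noteq> 0 \<and> (\<forall>x. h x \<noteq> 0 \<longrightarrow>
      (\<forall>c. (\<forall>i. (\<Sum>u\<in>A. c u * a u i x) = 0) \<longrightarrow> (\<forall>u\<in>A. c u = 0)))"
    by (intro ratpoly_family_indep_witness[OF fin])
  then obtain h where h: "h \<in> ratpoly ?I" "h q \<noteq> 0"
    "\<forall>x. h x \<noteq> 0 \<longrightarrow> (\<forall>c. (\<forall>i. (\<Sum>u\<in>A. c u * a u i x) = 0) \<longrightarrow> (\<forall>u\<in>A. c u = 0))"
    by (elim bexE conjE)
  have "alg_indep ?I (case_prod p)" using assms(1) unfolding generic_def .
  from ratpoly_nonzero_at_alg_indep[where f = h, OF _ h(1) this h(2)] have hp: "h (case_prod p) \<noteq> 0" by simp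
  show ?thesis unfolding aff_indep_def
  proof (intro allI impI)
    fix c assume c: "\<forall>i<d. (\<Sum>u\<in>A. c u * p u i) = 0" "(\<Sum>u\<in>A. c u) = 0"
    have "(\<Sum>u\<in>A. c u * a u i (case_prod p)) = 0" for i
      using c by (cases "i < d") (simp_all add: a_def)
    then have "\<forall>i. (\<Sum>u\<in>A. c u * a u i (case_prod p)) = 0" ..
    then show "\<forall>u\<in>A. c u = 0" by (rule h(3)[THEN spec, THEN mp, OF hp, THEN spec, THEN mp])
  qed
qed

text \<open>An affine dependency \<open>c\<close> of \<open>d + 2\<close> points yields the self-stress with weights
  \<open>c u * c v\<close>.\<close>

lemma edge_row_in_span_of_complete_minus_edge:
  assumes "card S = d" "finite S" "x \<notin> S" "y \<notin> S" "x \<noteq> y"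
    and indep: "\<And>B. \<lbrakk>B \<subseteq> insert x (insert y S); card B \<le> d + 1\<rbrakk> \<Longrightarrow> aff_indep d p B"
  defines "A \<equiv> insert x (insert y S)"
  shows "edge_row d p (x, y) \<in> fv.span (edge_row d p ` (A \<times> A - {(x, y), (y, x)}))"
proof -
  have fin: "finite A" and cardA: "card A = d + 2" using assms by (auto simp: A_def)
  \<comment> \<open>The constant entry at index \<open>d\<close> turns affine dependencies into
    linear ones: \<open>d + 2\<close> unknowns against \<open>d + 1\<close> equations.\<close>
  define f where "f = (\<lambda>u i. if i < d then p u i else 1)"
  obtain c where c: "\<exists>u\<in>A. c u \<noteq> 0" "\<And>i. i \<in> {..d} \<Longrightarrow> (\<Sum>u\<in>A. c u * f u i) = 0"
    using exists_linear_dependency[of "{..d}" A f] fin cardA by auto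
  have c_pt: "(\<Sum>u\<in>A. c u * p u i) = 0" if "i < d" for i
    using c(2)[of i] that by (simp add: f_def)
  have c_sum: "(\<Sum>u\<in>A. c u) = 0" using c(2)[of d] by (simp add: f_def)
  \<comment> \<open>A zero coefficient would leave an affine dependency among \<open>d + 1\<close>
    points. Nonzero \<open>c x\<close> and \<open>c y\<close> allow the stress to be solved for the
    row of \<open>(x, y)\<close>.\<close>
  have c_nz: "c z \<noteq> 0" if z: "z \<in> A" for z
  proof
    assume cz: "c z = 0"
    have "card (A - {z}) \<le> d + 1" using z cardA fin by simp
    then have "aff_indep d p (A - {z})" using indep[of "A - {z}"] by (auto simp: A_def)
    moreover have "\<forall>i<d. (\<Sum>u\<in>A - {z}. c u * p u i) = 0"
      using c_pt cz fin z by (simp add: sum.remove)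
    moreover have "(\<Sum>u\<in>A - {z}. c u) = 0" using c_sum cz fin z by (simp add: sum.remove)
    ultimately have "\<forall>u\<in>A - {z}. c u = 0" unfolding aff_indep_def by blast
    then show False using c(1) cz by blast
  qed
  define s where "s e = (\<lambda>j. c (fst e) * c (snd e) * edge_row d p e j)" for e
  have total: "(\<Sum>e\<in>A \<times> A. s e j) = 0" for j
  proof -
    obtain w i where j: "j = (w, i)" by (cases j)
    show ?thesis
    proof (cases "i < d")
      case False
      then show ?thesis by (simp add: s_def edge_row_def j case_prod_beta)
    next
      case True
      have lin: "(\<Sum>v\<in>A. c w * c v * (p w i - p v i)) = 0"
      proof -
        have "(\<Sum>v\<in>A. c w * c v * (p w i - p v i)) =
            (\<Sum>v\<in>A. c w * p w i * c v - c w * (c v * p v i))"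
          by (intro sum.cong) (simp_all add: algebra_simps)
        also have "\<dots> = c w * p w i * (\<Sum>v\<in>A. c v) - c w * (\<Sum>v\<in>A. c v * p v i)"
          by (simp only: sum_subtractf sum_distrib_left)
        finally show ?thesis using c_sum c_pt[OF True] by simp
      qed
      have s: "s (u, v) j = (if u = w then c w * c v * (p w i - p v i) else 0) +
          (if v = w then c w * c u * (p w i - p u i) else 0)" for u v
        using True by (auto simp: s_def edge_row_def j)
      have "(\<Sum>e\<in>A \<times> A. s e j) = (\<Sum>u\<in>A. \<Sum>v\<in>A. s (u, v) j)"
        by (simp add: sum.cartesian_product)
      also have "\<dots> = (\<Sum>u\<in>A. \<Sum>v\<in>A. if u = w then c w * c v * (p w i - p v i) else 0) +
          (\<Sum>u\<in>A. \<Sum>v\<in>A. if v = w then c w * c u * (p w i - p u i) else 0)"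
        unfolding s by (simp only: sum.distrib)
      also have "(\<Sum>u\<in>A. \<Sum>v\<in>A. if v = w then c w * c u * (p w i - p u i) else 0) =
          (\<Sum>v\<in>A. \<Sum>u\<in>A. if v = w then c w * c u * (p w i - p u i) else 0)"
        by (rule sum.swap)
      also have "(\<Sum>u\<in>A. \<Sum>v\<in>A. if u = w then c w * c v * (p w i - p v i) else 0) =
          (\<Sum>u\<in>A. if u = w then (\<Sum>v\<in>A. c w * c v * (p w i - p v i)) else 0)"
        by (intro sum.cong) auto
      also have "\<dots> = 0" unfolding lin by simp
      finally show ?thesis unfolding lin by simp
    qed
  qed
  let ?R = "A \<times> A - {(x, y), (y, x)}"
  \<comment> \<open>Both orders of the missing edge occur in \<open>A \<times> A\<close> with the
    same row, hence the factor 2 below.\<close>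
  have xy: "(x, y) \<in> A \<times> A" "(y, x) \<in> A \<times> A - {(x, y)}" using assms(5) by (auto simp: A_def)
  have fin2: "finite (A \<times> A)" using fin by simp
  have "(\<Sum>e\<in>A \<times> A. s e j) = s (x, y) j + (s (y, x) j + (\<Sum>e\<in>?R. s e j))" for j
  proof -
    have "?R = A \<times> A - {(x, y)} - {(y, x)}" by blast
    then show ?thesis
      using sum.remove[OF fin2 xy(1), of "\<lambda>e. s e j"] sum.remove[OF _ xy(2), of "\<lambda>e. s e j"] fin2
      by simp
  qed
  then have split: "s (x, y) j + (s (y, x) j + (\<Sum>e\<in>?R. s e j)) = 0" for j
    using total[of j] by metis
  have s_xy: "s (x, y) j = c x * c y * edge_row d p (x, y) j" "s (y, x) j = c x * c y * edge_row d p (x, y) j" for j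
    by (simp_all add: s_def edge_row_sym[of d p y x])
  have eq: "2 * c x * c y * edge_row d p (x, y) j + (\<Sum>e\<in>?R. s e j) = 0" for j
    using split[of j] unfolding s_xy by linarith
  have row_eq: "edge_row d p (x, y) = (\<Sum>e\<in>?R. (\<lambda>j. (- (c (fst e) * c (snd e)) / (2 * c x * c y)) * edge_row d p e j))"
  proof
    fix j
    have nz: "2 * c x * c y \<noteq> 0" using c_nz by (simp add: A_def)
    have "2 * c x * c y * edge_row d p (x, y) j = - (\<Sum>e\<in>?R. s e j)"
      using eq[of j] by linarith
    then have "edge_row d p (x, y) j = - (\<Sum>e\<in>?R. s e j) / (2 * c x * c y)"
      using nz by (metis nonzero_mult_div_cancel_left)
    also have "\<dots> = (\<Sum>e\<in>?R. - s e j / (2 * c x * c y))"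
      by (simp add: sum_divide_distrib sum_negf)
    also have "\<dots> = (\<Sum>e\<in>?R. (\<lambda>j. (- (c (fst e) * c (snd e)) / (2 * c x * c y)) * edge_row d p e j)) j"
      unfolding sum_fun_apply by (intro sum.cong) (auto simp: s_def)
    finally show "edge_row d p (x, y) j =
      (\<Sum>e\<in>?R. (\<lambda>j. (- (c (fst e) * c (snd e)) / (2 * c x * c y)) * edge_row d p e j)) j" .
  qed
  show ?thesis unfolding row_eq
    by (intro fv.span_sum fv.span_scale fv.span_base imageI)
qed

text \<open>Vectors in \<open>S\<close> are 0 in the coordinates of \<open>v\<close>, so those
  coordinates alone show that no star row depends on the rest. Independent directions at
  \<open>v\<close> thus add their number to the dimension.\<close>

lemma dim_star:
  assumes "finite N" "v \<notin> N" "finite S" "\<And>f i. f \<in> S \<Longrightarrow> f (v, i) = 0"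
    and "\<And>c. \<forall>i<d. (\<Sum>u\<in>N. c u * (p v i - p u i)) = 0 \<Longrightarrow> \<forall>u\<in>N. c u = 0"
  shows "fv.dim (S \<union> edge_row d p ` ({v} \<times> N)) = fv.dim S + card N"
  using assms(1,2,5)
proof (induction N)
  case empty
  show ?case by simp
next
  case (insert z N)
  let ?T = "S \<union> edge_row d p ` ({v} \<times> N)"
  have span0: "f (v, i) = 0" if "f \<in> fv.span S" for f i
    using that by (induction rule: fv.span_induct_alt) (use assms(4) in auto)
  have at_v: "edge_row d p (v, u) (v, i) = p v i - p u i" if "i < d" for u i
    using that by (simp add: edge_row_def)
  have "edge_row d p (v, z) \<notin> fv.span ?T"
  proof
    assume "edge_row d p (v, z) \<in> fv.span ?T"
    then obtain f t where ft: "edge_row d p (v, z) = f + t" "f \<in> fv.span S"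
      "t \<in> fv.span (edge_row d p ` ({v} \<times> N))"
      unfolding fv.span_Un by blast
    have "edge_row d p ` ({v} \<times> N) = (\<lambda>u. edge_row d p (v, u)) ` N" by auto
    then obtain c where t: "t = (\<Sum>u\<in>N. (\<lambda>j. c u * edge_row d p (v, u) j))"
      using fv.span_image_finite[OF insert.hyps(1)] ft(3) by metis
    define c' where "c' = c(z := -1)"
    have "(\<Sum>u\<in>insert z N. c' u * (p v i - p u i)) = 0" if i: "i < d" for i
    proof -
      have "p v i - p z i = f (v, i) + t (v, i)"
        using fun_cong[OF ft(1), of "(v, i)"] at_v[OF i] by simp
      also have "\<dots> = (\<Sum>u\<in>N. c u * (p v i - p u i))"
        using span0[OF ft(2)] at_v[OF i] by (simp add: t sum_fun_apply)
      also have "\<dots> = (\<Sum>u\<in>N. c' u * (p v i - p u i))"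
        using insert.hyps by (intro sum.cong) (auto simp: c'_def)
      finally show ?thesis using insert.hyps by (simp add: c'_def)
    qed
    then have "c' z = 0" using insert.prems(2) by blast
    then show False by (simp add: c'_def)
  qed
  then have "fv.dim (insert (edge_row d p (v, z)) ?T) = Suc (fv.dim ?T)"
    using insert.hyps assms(3) by (intro fv.dim_insert_notin_span) auto
  moreover have "fv.dim ?T = fv.dim S + card N"
  proof (rule insert.IH)
    show "v \<notin> N" using insert.prems(1) by simp
    fix c assume c: "\<forall>i<d. (\<Sum>u\<in>N. c u * (p v i - p u i)) = 0"
    have "(\<Sum>u\<in>insert z N. (c(z := 0)) u * (p v i - p u i)) = (\<Sum>u\<in>N. c u * (p v i - p u i))" for i
      using insert.hyps by (simp add: sum.insert) (intro sum.cong, auto)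
    then have "\<forall>u\<in>insert z N. (c(z := 0)) u = 0" using insert.prems(2)[of "c(z := 0)"] c by simp
    then show "\<forall>u\<in>N. c u = 0" using insert.hyps by (metis fun_upd_other insertCI)
  qed
  moreover have "S \<union> edge_row d p ` ({v} \<times> insert z N) = insert (edge_row d p (v, z)) ?T" by auto
  ultimately show ?case using insert.hyps by simp
qed

lemma aff_indep_star:
  assumes "aff_indep d p (insert v N)" "finite N" "v \<notin> N"
    and "\<forall>i<d. (\<Sum>u\<in>N. c u * (p v i - p u i)) = 0"
  shows "\<forall>u\<in>N. c u = 0"
proof -
  define c' where "c' = (\<lambda>u. if u = v then - (\<Sum>u\<in>N. c u) else c u)"
  have eq: "(\<Sum>u\<in>N. c' u * g u) = (\<Sum>u\<in>N. c u * g u)" for g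
    using assms(3) by (intro sum.cong) (auto simp: c'_def)
  have "(\<Sum>u\<in>insert v N. c' u * p u i) = 0" if i: "i < d" for i
  proof -
    have "(\<Sum>u\<in>N. c u * (p v i - p u i)) = (\<Sum>u\<in>N. c u) * p v i - (\<Sum>u\<in>N. c u * p u i)"
      by (simp add: right_diff_distrib sum_subtractf sum_distrib_right)
    then have "(\<Sum>u\<in>N. c u) * p v i = (\<Sum>u\<in>N. c u * p u i)" using assms(4) i by simp
    then show ?thesis using assms(2,3) eq[of "\<lambda>u. p u i"] by (simp add: c'_def)
  qed
  moreover have "(\<Sum>u\<in>insert v N. c' u) = 0"
    using assms(2,3) eq[of "\<lambda>_. 1"] by (simp add: c'_def)
  ultimately have "\<forall>u\<in>insert v N. c' u = 0" using assms(1) unfolding aff_indep_def by blast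
  then show ?thesis using assms(3) unfolding c'_def by (metis insertCI)
qed

subsection \<open>The closure in the generic rigidity matroid\<close>

text \<open>The merging of cliques: \<open>S\<close> with \<open>x\<close> and \<open>y\<close>
  carries a complete graph on \<open>d + 2\<close> vertices lacking one edge, and the other rows
  already span the row of that edge.\<close>

lemma edge_row_sub_span_of_complete_minus_edge:
  assumes "generic n d p" "S \<subseteq> {..<n}" "card S = d" "x < n" "y < n" "x \<noteq> y" "x \<notin> S" "y \<notin> S"
    and "\<And>s t. \<lbrakk>s \<in> S; t \<in> S; s \<noteq> t\<rbrakk> \<Longrightarrow> edge_row d p (s, t) \<in> fv.span R"
    and "\<And>s. s \<in> S \<Longrightarrow> edge_row d p (x, s) \<in> fv.span R \<and> edge_row d p (y, s) \<in> fv.span R"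
  shows "edge_row d p (x, y) \<in> fv.span R"
proof -
  let ?A = "insert x (insert y S)"
  have fin: "finite S" using assms(2) finite_subset by blast
  have "edge_row d p (x, y) \<in> fv.span (edge_row d p ` (?A \<times> ?A - {(x, y), (y, x)}))"
  proof (rule edge_row_in_span_of_complete_minus_edge)
    fix B assume "B \<subseteq> ?A" "card B \<le> d + 1"
    moreover have "?A \<subseteq> {..<n}" using assms(2,4,5) by auto
    ultimately show "aff_indep d p B" using generic_aff_indep[OF assms(1)] by (meson order_trans)
  qed (use assms fin in auto)
  also have "\<dots> \<subseteq> fv.span (fv.span R)"
  proof (rule fv.span_mono, rule image_subsetI)
    fix e assume e: "e \<in> ?A \<times> ?A - {(x, y), (y, x)}"
    obtain u v where uv: "e = (u, v)" by (cases e)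
    consider "u = v" | "u \<noteq> v" "u \<in> S" "v \<in> S" | "u \<in> {x, y}" "v \<in> S" | "u \<in> S" "v \<in> {x, y}"
      using e uv by blast
    then show "edge_row d p e \<in> fv.span R"
    proof cases
      case 1
      then show ?thesis using uv edge_row_self fv.span_zero by simp
    next
      case 2
      then show ?thesis using assms(9) uv by simp
    next
      case 3
      then show ?thesis using assms(10)[of v] uv by auto
    next
      case 4
      then show ?thesis using assms(10)[of u] uv edge_row_sym[of d p u v] by auto
    qed
  qed
  finally show ?thesis by (simp add: fv.span_span)
qed

lemma rk_subset:
  assumes "finite Q" "P \<subseteq> Q"
  shows "rk d p P \<le> rk d p Q"
  using assms fv.span_superset image_mono by (intro rk_mono) fast+

lemma rk_complete_le:
  assumes "generic n d p" "d \<le> n"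
  shows "real (rk d p ({..<n} \<times> {..<n})) + real (d * (d + 1)) / 2 \<le> real (d * n)"
proof -
  \<comment> \<open>A spanning set of \<open>d (d - 1) / 2 + d (n - d) = d n - d (d + 1) / 2\<close>
    rows: the complete graph on the first \<open>d\<close> vertices and all edges from these to the
    others. Any further pair follows by merging along \<open>{..<d}\<close>.\<close>
  let ?T = "{(u, v). u < v \<and> v < d} \<union> {..<d} \<times> {d..<n}"
  have T1: "{(u, v). u < v \<and> v < d} = (SIGMA v:{..<d}. {..<v})\<inverse>" by auto
  have card_T1: "card {(u, v). u < v \<and> v < d} = (\<Sum>v<d. v)"
    unfolding T1 card_inverse by simp
  have fin_T1: "finite {(u, v). u < v \<and> v < d}" unfolding T1 by simp
  have fin: "finite ?T" using fin_T1 by simp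
  have base: "edge_row d p (u, v) \<in> fv.span (edge_row d p ` ?T)" if "u < d" "v < n" for u v
  proof -
    have "u = v \<or> (u, v) \<in> ?T \<or> (v, u) \<in> ?T" using that by (cases "v < d") auto
    then consider "u = v" | "(u, v) \<in> ?T" | "(v, u) \<in> ?T" by blast
    then show ?thesis
    proof cases
      case 1
      then show ?thesis using edge_row_self fv.span_zero by simp
    next
      case 2
      then show ?thesis by (intro fv.span_base imageI)
    next
      case 3
      then have "edge_row d p (v, u) \<in> fv.span (edge_row d p ` ?T)" by (intro fv.span_base imageI)
      then show ?thesis by (simp add: edge_row_sym[of d p u v])
    qed
  qed
  have "edge_row d p (u, v) \<in> fv.span (edge_row d p ` ?T)" if uv: "u < n" "v < n" for u v
  proof -
    consider "u < d" | "v < d" | "u = v" | "d \<le> u" "d \<le> v" "u \<noteq> v" by linarith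
    then show ?thesis
    proof cases
      case 1
      then show ?thesis using base uv by blast
    next
      case 2
      then have "edge_row d p (v, u) \<in> fv.span (edge_row d p ` ?T)" using base uv by blast
      then show ?thesis by (simp add: edge_row_sym[of d p u v])
    next
      case 3
      then show ?thesis using edge_row_self fv.span_zero by simp
    next
      case 4
      show ?thesis
      proof (rule edge_row_sub_span_of_complete_minus_edge[OF assms(1), of "{..<d}"])
        fix s assume "s \<in> {..<d}"
        then show "edge_row d p (u, s) \<in> fv.span (edge_row d p ` ?T) \<and> edge_row d p (v, s) \<in> fv.span (edge_row d p ` ?T)"
          using base[of s u] base[of s v] uv edge_row_sym[of d p u s] edge_row_sym[of d p v s] by simp
      qed (use 4 uv assms(2) base in auto)
    qed
  qed
  then have "rk d p ({..<n} \<times> {..<n}) \<le> rk d p ?T" using fin by (intro rk_mono) auto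
  also have "\<dots> \<le> card ?T"
    unfolding rk_def using fv.dim_le_card'[of "edge_row d p ` ?T"] card_image_le[OF fin, of "edge_row d p"] fin
    by simp
  also have "\<dots> \<le> (\<Sum>v<d. v) + d * (n - d)"
    using card_Un_le[of "{(u, v). u < v \<and> v < d}" "{..<d} \<times> {d..<n}"] card_T1 by simp
  finally have "rk d p ({..<n} \<times> {..<n}) \<le> (\<Sum>v<d. v) + d * (n - d)" .
  then have "real (rk d p ({..<n} \<times> {..<n})) \<le> real (\<Sum>v<d. v) + d * (real n - d)"
    using assms(2) by (metis of_nat_add of_nat_diff of_nat_le_iff of_nat_mult)
  moreover have "real (\<Sum>v<d. v) = d * (real d - 1) / 2"
    by (induction d) (auto simp: field_simps)
  ultimately show ?thesis by (simp add: field_simps)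
qed

definition edge_pairs :: "nat set set \<Rightarrow> (nat \<times> nat) set" where
  "edge_pairs E = {(u, v). {u, v} \<in> E}"

lemma edge_pairs_sub:
  assumes "simple_graph n E"
  shows "edge_pairs E \<subseteq> {..<n} \<times> {..<n}"
  using assms unfolding simple_graph_def edge_pairs_def by (fastforce simp: doubleton_eq_iff)

text \<open>Adjacency in the closure of \<open>E\<close> in the matroid of rows at \<open>p\<close>,
  which is the generic rigidity matroid when \<open>p\<close> is generic.\<close>

definition span_adj :: "nat \<Rightarrow> nat \<Rightarrow> (nat \<Rightarrow> nat \<Rightarrow> real) \<Rightarrow> nat set set \<Rightarrow> nat \<Rightarrow> nat \<Rightarrow> bool" where
  "span_adj n d p E u v \<longleftrightarrow>
    u < n \<and> v < n \<and> u \<noteq> v \<and> edge_row d p (u, v) \<in> fv.span (edge_row d p ` edge_pairs E)"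

definition adj_pairs :: "nat \<Rightarrow> nat \<Rightarrow> (nat \<Rightarrow> nat \<Rightarrow> real) \<Rightarrow> nat set set \<Rightarrow> nat set \<Rightarrow> (nat \<times> nat) set" where
  "adj_pairs n d p E W = {(u, v). u \<in> W \<and> v \<in> W \<and> span_adj n d p E u v}"

lemma adj_pairs_sub: "adj_pairs n d p E W \<subseteq> {..<n} \<times> {..<n}"
  by (auto simp: adj_pairs_def span_adj_def)

lemma adj_pairs_finite: "finite (adj_pairs n d p E W)"
  using adj_pairs_sub by (rule finite_subset) simp

text \<open>A 0-extension: \<open>v\<close> and at most \<open>d\<close> chosen neighbours are at
  most \<open>d + 1\<close> points in general position, so the directions from \<open>v\<close> are
  independent.\<close>

lemma rk_adj_pairs_add_vertex:
  assumes "generic n d p" "W \<subseteq> {..<n}" "v \<in> W"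
  shows "rk d p (adj_pairs n d p E (W - {v})) + min d (card {u \<in> W. span_adj n d p E v u})
    \<le> rk d p (adj_pairs n d p E W)"
proof -
  let ?N = "{u \<in> W. span_adj n d p E v u}"
  let ?S = "edge_row d p ` adj_pairs n d p E (W - {v})"
  obtain N where N: "N \<subseteq> ?N" "card N = min d (card ?N)"
    using obtain_subset_with_card_n[of "min d (card ?N)" ?N] by auto
  have finN: "finite N" using N(1) assms(2) by (intro finite_subset[of N "{..<n}"]) auto
  have vN: "v \<notin> N" using N(1) by (auto simp: span_adj_def)
  have "card (insert v N) \<le> d + 1" using N(2) finN vN by simp
  then have indep: "aff_indep d p (insert v N)"
    using N(1) assms by (intro generic_aff_indep[OF assms(1)]) auto
  have "fv.dim (?S \<union> edge_row d p ` ({v} \<times> N)) = fv.dim ?S + card N"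
  proof (rule dim_star[OF finN vN])
    show "f (v, i) = 0" if "f \<in> ?S" for f i
      using that by (auto simp: adj_pairs_def edge_row_def)
  qed (use aff_indep_star[OF indep finN vN] adj_pairs_finite in auto)
  also have "?S \<union> edge_row d p ` ({v} \<times> N) = edge_row d p ` (adj_pairs n d p E (W - {v}) \<union> {v} \<times> N)"
    by blast
  finally have "rk d p (adj_pairs n d p E (W - {v})) + card N =
      rk d p (adj_pairs n d p E (W - {v}) \<union> {v} \<times> N)"
    unfolding rk_def by simp
  also have "\<dots> \<le> rk d p (adj_pairs n d p E W)"
  proof (rule rk_subset[OF adj_pairs_finite])
    have "w \<in> W \<and> span_adj n d p E v w" if "w \<in> N" for w using N(1) that by blast
    then show "adj_pairs n d p E (W - {v}) \<union> {v} \<times> N \<subseteq> adj_pairs n d p E W"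
      using assms(3) unfolding adj_pairs_def by auto
  qed
  finally show ?thesis using N(2) by simp
qed

text \<open>The 1-extension argument: with \<open>v\<close> moved to the midpoint of \<open>x\<close> and \<open>y\<close>, the row of
  \<open>xy\<close> is twice the sum of those of \<open>vx\<close> and \<open>vy\<close>, and no position has larger rank than
  a generic one.\<close>

lemma rk_adj_pairs_add_vertex_nonclique:
  assumes gen: "generic n d p" and d: "d > 0" and W: "W \<subseteq> {..<n}" "v \<in> W"
    and deg: "d < card {u \<in> W. span_adj n d p E v u}"
    and xy: "x \<in> W" "y \<in> W" "span_adj n d p E v x" "span_adj n d p E v y" "x \<noteq> y"
    and nadj: "\<not> span_adj n d p E x y"
  shows "rk d p (adj_pairs n d p E (W - {v})) + d + 1 \<le> rk d p (adj_pairs n d p E W)"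
proof -
  let ?N = "{u \<in> W. span_adj n d p E v u}"
  let ?F = "adj_pairs n d p E (W - {v})"
  have finN': "finite ?N" using W(1) by (intro finite_subset[of ?N "{..<n}"]) auto
  have "card ?N = Suc (Suc (card (?N - {x, y})))"
    using card_Diff_subset[of "{x, y}" ?N] xy deg d by (simp add: card_insert_if)
  then have "d - 1 \<le> card (?N - {x, y})" using deg by linarith
  \<comment> \<open>\<open>N\<close> will consist of \<open>d\<close> neighbours including
    \<open>x\<close> but not \<open>y\<close>; the edge from \<open>v\<close> to \<open>y\<close> is
    held back to recover the row of \<open>(x, y)\<close>.\<close>
  then obtain N0 where N0: "N0 \<subseteq> ?N - {x, y}" "card N0 = d - 1"
    using obtain_subset_with_card_n by metis
  define N where "N = insert x N0"
  have finN0: "finite N0" using N0(1) finN' finite_subset by blast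
  have N0': "x \<notin> N0" "y \<notin> N0" "v \<notin> N0" "N0 \<subseteq> ?N" using N0(1) by (auto simp: span_adj_def)
  have N: "finite N" "card N = d" "x \<in> N" "y \<notin> N" "v \<notin> N" "insert y N \<subseteq> ?N"
    using N0(2) N0' d xy finN0 by (auto simp: N_def span_adj_def)
  have yv: "y \<noteq> v" "x \<noteq> v" using xy by (auto simp: span_adj_def)
  define q where "q = p(v := \<lambda>i. (p x i + p y i) / 2)"
  have q_other: "edge_row d q (a, b) = edge_row d p (a, b)" if "a \<noteq> v" "b \<noteq> v" for a b
    using that by (intro edge_row_cong) (auto simp: q_def)
  have F_other: "edge_row d q ` ?F = edge_row d p ` ?F"
    using q_other by (intro image_cong refl) (auto simp: adj_pairs_def)
  have mid: "edge_row d q (x, y) = (\<lambda>j. 2 * (edge_row d q (v, x) + edge_row d q (v, y)) j)"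
    using yv by (auto simp: edge_row_def q_def fun_eq_iff field_simps)
  let ?S = "insert (edge_row d p (x, y)) (edge_row d p ` ?F)"
  \<comment> \<open>Since \<open>(x, y)\<close> is missing from the closure, its row adds one to the
    rank before the \<open>d\<close> edges at \<open>v\<close> add theirs.\<close>
  have "edge_row d p (x, y) \<notin> fv.span (edge_row d p ` ?F)"
  proof
    assume "edge_row d p (x, y) \<in> fv.span (edge_row d p ` ?F)"
    also have "\<dots> \<subseteq> fv.span (fv.span (edge_row d p ` edge_pairs E))"
      by (intro fv.span_mono) (auto simp: adj_pairs_def span_adj_def)
    finally show False using nadj xy by (auto simp: span_adj_def fv.span_span)
  qed
  then have dimS: "fv.dim ?S = Suc (rk d p ?F)"
    unfolding rk_def using adj_pairs_finite by (intro fv.dim_insert_notin_span) auto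
  have "card (insert y N) \<le> d + 1" using N by simp
  then have indep: "aff_indep d p (insert y N)"
    using N(6) W by (intro generic_aff_indep[OF gen]) auto
  have "fv.dim (?S \<union> edge_row d q ` ({v} \<times> N)) = fv.dim ?S + card N"
  proof (rule dim_star[OF N(1,5)])
    show "f (v, i) = 0" if "f \<in> ?S" for f i
      using that yv by (auto simp: adj_pairs_def edge_row_def)
    fix c assume c: "\<forall>i<d. (\<Sum>u\<in>N. c u * (q v i - q u i)) = 0"
    define s where "s = (\<Sum>u\<in>N. c u)"
    \<comment> \<open>As \<open>v\<close> sits at the midpoint, a dependency of its directions is an
      affine dependency of \<open>insert y N\<close>: the total weight \<open>s\<close> goes half to
      \<open>x\<close> and half to \<open>y\<close>.\<close>
    define c' where "c' = (\<lambda>u. if u = y then s / 2 else if u = x then s / 2 - c x else - c u)"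
    have split: "(\<Sum>u\<in>insert y N. c' u * g u) = s / 2 * (g x + g y) - (\<Sum>u\<in>N. c u * g u)" for g
    proof -
      have "(\<Sum>u\<in>N. c' u * g u) = (\<Sum>u\<in>N. (if u = x then s / 2 * g u else 0) - c u * g u)"
        using N(4) xy(5) by (intro sum.cong) (auto simp: c'_def left_diff_distrib)
      also have "\<dots> = s / 2 * g x - (\<Sum>u\<in>N. c u * g u)"
        using N(1,3) by (simp add: sum_subtractf)
      finally show ?thesis using N(1,4) by (simp add: c'_def distrib_left)
    qed
    have "(\<Sum>u\<in>insert y N. c' u * p u i) = 0" if i: "i < d" for i
    proof -
      have "(\<Sum>u\<in>N. c u * ((p x i + p y i) / 2 - p u i)) = (\<Sum>u\<in>N. c u * (q v i - q u i))"
        using N(5) by (intro sum.cong) (auto simp: q_def)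
      also have "\<dots> = 0" using c i by simp
      finally have "s * ((p x i + p y i) / 2) - (\<Sum>u\<in>N. c u * p u i) = 0"
        by (simp only: right_diff_distrib sum_subtractf s_def sum_distrib_right)
      then show ?thesis unfolding split by simp
    qed
    moreover have "(\<Sum>u\<in>insert y N. c' u) = 0"
      using split[of "\<lambda>_. 1"] by (simp add: s_def)
    ultimately have z: "\<forall>u\<in>insert y N. c' u = 0" using indep unfolding aff_indep_def by blast
    then have "s = 0" by (simp add: c'_def)
    show "\<forall>u\<in>N. c u = 0"
    proof
      fix u assume u: "u \<in> N"
      then have "c' u = 0" using z by blast
      then show "c u = 0" using u N(4) \<open>s = 0\<close> by (auto simp: c'_def split: if_splits)
    qed
  qed (use adj_pairs_finite in auto)
  then have "rk d p ?F + d + 1 = fv.dim (?S \<union> edge_row d q ` ({v} \<times> N))"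
    using dimS N(2) by simp
  also have "\<dots> \<le> rk d q (?F \<union> {v} \<times> insert y N)"
    unfolding rk_def
  proof (rule fv.dim_mono_finite)
    let ?R = "fv.span (edge_row d q ` (?F \<union> {v} \<times> insert y N))"
    show "finite (edge_row d q ` (?F \<union> {v} \<times> insert y N))" using adj_pairs_finite N(1) by blast
    have base: "edge_row d q e \<in> ?R" if "e \<in> ?F \<union> {v} \<times> insert y N" for e
      using that by (intro fv.span_base imageI)
    have "edge_row d q (x, y) \<in> ?R"
      unfolding mid using N(3) by (intro fv.span_scale fv.span_add base) auto
    then have "edge_row d p (x, y) \<in> ?R" using q_other yv by simp
    moreover have "edge_row d p ` ?F \<subseteq> ?R" using base unfolding F_other[symmetric] by blast
    moreover have "edge_row d q ` ({v} \<times> N) \<subseteq> ?R" using base by blast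
    ultimately show "?S \<union> edge_row d q ` ({v} \<times> N) \<subseteq> ?R" by blast
  qed
  also have "\<dots> \<le> rk d p (?F \<union> {v} \<times> insert y N)"
  proof (rule rk_le_generic[OF gen])
    show "?F \<union> {v} \<times> insert y N \<subseteq> {..<n} \<times> {..<n}"
      using adj_pairs_sub[of n d p E "W - {v}"] N(6) W by auto
  qed
  also have "\<dots> \<le> rk d p (adj_pairs n d p E W)"
  proof (rule rk_subset[OF adj_pairs_finite])
    have "w \<in> W \<and> span_adj n d p E v w" if "w \<in> insert y N" for w using N(6) that by blast
    then show "?F \<union> {v} \<times> insert y N \<subseteq> adj_pairs n d p E W"
      using W(2) unfolding adj_pairs_def by auto
  qed
  finally show ?thesis .
qed

lemma rigidity_closure_span_adj:
  assumes gen: "generic n d p" and d: "d > 0"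
  shows "rigidity_closure {..<n} (span_adj n d p E) d (\<lambda>W. rk d p (adj_pairs n d p E W))"
proof
  show "span_adj n d p E v u" if "span_adj n d p E u v" for u v
    using that edge_row_sym[of d p u v] by (auto simp: span_adj_def)
  show "span_adj n d p E x y"
    if "S \<subseteq> {..<n}" "card S = d" "\<And>s t. \<lbrakk>s \<in> S; t \<in> S; s \<noteq> t\<rbrakk> \<Longrightarrow> span_adj n d p E s t"
      "x \<in> {..<n}" "y \<in> {..<n}" "x \<noteq> y" "\<And>s. s \<in> S \<Longrightarrow> span_adj n d p E x s \<and> span_adj n d p E y s"
    for S x y
  proof -
    have S: "x \<notin> S" "y \<notin> S" using that(7) by (auto simp: span_adj_def)
    have "edge_row d p (x, y) \<in> fv.span (edge_row d p ` edge_pairs E)"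
    proof (rule edge_row_sub_span_of_complete_minus_edge[OF gen that(1,2) _ _ that(6) S])
      show "edge_row d p (s, t) \<in> fv.span (edge_row d p ` edge_pairs E)" if "s \<in> S" "t \<in> S" "s \<noteq> t" for s t
        using \<open>\<And>s t. \<lbrakk>s \<in> S; t \<in> S; s \<noteq> t\<rbrakk> \<Longrightarrow> span_adj n d p E s t\<close>[OF that]
        unfolding span_adj_def by blast
      show "edge_row d p (x, s) \<in> fv.span (edge_row d p ` edge_pairs E) \<and>
          edge_row d p (y, s) \<in> fv.span (edge_row d p ` edge_pairs E)" if "s \<in> S" for s
        using \<open>\<And>s. s \<in> S \<Longrightarrow> span_adj n d p E x s \<and> span_adj n d p E y s\<close>[OF that]
        unfolding span_adj_def by blast
    qed (use that(4,5) in auto)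
    then show ?thesis using that(4-6) by (simp add: span_adj_def)
  qed
  show "u \<in> {..<n}" if "span_adj n d p E u v" for u v
    using that by (simp add: span_adj_def)
  show "\<not> span_adj n d p E v v" for v by (simp add: span_adj_def)
qed (use rk_adj_pairs_add_vertex[OF gen] rk_adj_pairs_add_vertex_nonclique[OF gen d] in simp_all)

lemma ore_imp_full_rank:
  assumes gen: "generic n d p" and d: "d > 0" and n: "d * (d + 2) \<le> n" and E: "simple_graph n E"
    and ore: "\<And>u v. \<lbrakk>u < n; v < n; u \<noteq> v; {u, v} \<notin> E\<rbrakk> \<Longrightarrow> n + d - 2 \<le> degree E u + degree E v"
  shows "rk d p ({..<n} \<times> {..<n}) \<le> rk d p (edge_pairs E)"
proof -
  interpret rigidity_closure "{..<n}" "span_adj n d p E" d "\<lambda>W. rk d p (adj_pairs n d p E W)"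
    using gen d by (rule rigidity_closure_span_adj)
  have finE: "finite (edge_pairs E)"
    using edge_pairs_sub[OF E] by (rule finite_subset) simp
  have adj_E: "span_adj n d p E u v" if "{u, v} \<in> E" for u v
  proof -
    have "u < n \<and> v < n \<and> u \<noteq> v" using E that unfolding simple_graph_def by (fastforce simp: doubleton_eq_iff)
    moreover have "edge_row d p (u, v) \<in> fv.span (edge_row d p ` edge_pairs E)"
      using that by (intro fv.span_base imageI) (simp add: edge_pairs_def)
    ultimately show ?thesis by (simp add: span_adj_def)
  qed
  have deg: "degree E u \<le> card (nbrs {..<n} u)" for u
  proof -
    have "{v. {u, v} \<in> E} \<subseteq> nbrs {..<n} u"
      using adj_E by (auto simp: nbrs_def span_adj_def)
    then show ?thesis unfolding degree_def nbrs_def by (intro card_mono) auto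
  qed
  show ?thesis
  proof (cases "clique {..<n}")
    case True
    show ?thesis
    proof (rule rk_mono[OF finE], rule image_subsetI)
      fix e assume "e \<in> {..<n} \<times> {..<n}"
      then obtain u v where e: "e = (u, v)" "u < n" "v < n" by auto
      then show "edge_row d p e \<in> fv.span (edge_row d p ` edge_pairs E)"
        using True edge_row_self fv.span_zero
        by (cases "u = v") (auto simp: clique_def span_adj_def)
    qed
  next
    case False
    have "d * card {..<n} - d * (d + 1) / 2 \<le> real (rk d p (adj_pairs n d p E {..<n}))"
    proof (rule rank_ge_of_ore[OF d refl _ _ False])
      show "d * (d + 2) \<le> card {..<n}" using n by simp
      fix u v assume "u \<in> {..<n}" "v \<in> {..<n}" "u \<noteq> v" "\<not> span_adj n d p E u v"
      then have "n + d - 2 \<le> degree E u + degree E v" using ore adj_E by blast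
      then show "card {..<n} + d - 2 \<le> card (nbrs {..<n} u) + card (nbrs {..<n} v)"
        using deg[of u] deg[of v] by simp
    qed
    moreover have "rk d p (adj_pairs n d p E {..<n}) \<le> rk d p (edge_pairs E)"
      by (intro rk_mono[OF finE]) (auto simp: adj_pairs_def span_adj_def)
    moreover have "d \<le> n"
    proof -
      have "d \<le> d * (d + 2)" by simp
      then show ?thesis using n by (rule order_trans)
    qed
    note rk_complete_le[OF gen this]
    ultimately show ?thesis by simp
  qed
qed

subsection \<open>Continuous rigidity\<close>

lemma edge_row_apply:
  assumes "i < d"
  shows "edge_row d p (u, v) (w, i) =
    ((if w = u then 1 else 0) - (if w = v then 1 else 0)) * (p u i - p v i)"
  using assms by (simp add: edge_row_def)

lemma sum_edge_row:
  assumes "u < n" "v < n"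
  shows "(\<Sum>w<n. \<Sum>i<d. edge_row d p (u, v) (w, i) * x w i) = (\<Sum>i<d. (p u i - p v i) * (x u i - x v i))"
proof -
  have "(\<Sum>w<n. \<Sum>i<d. edge_row d p (u, v) (w, i) * x w i) =
      (\<Sum>i<d. \<Sum>w<n. edge_row d p (u, v) (w, i) * x w i)"
    by (rule sum.swap)
  also have "\<dots> = (\<Sum>i<d. (p u i - p v i) * (x u i - x v i))"
  proof (rule sum.cong[OF refl])
    fix i assume "i \<in> {..<d}"
    then have "(\<Sum>w<n. edge_row d p (u, v) (w, i) * x w i) =
        (\<Sum>w<n. (if w = u then (p u i - p v i) * x w i else 0) - (if w = v then (p u i - p v i) * x w i else 0))"
      by (intro sum.cong) (auto simp: edge_row_apply algebra_simps)
    also have "\<dots> = (p u i - p v i) * (x u i - x v i)"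
      using assms by (simp add: sum_subtractf right_diff_distrib)
    finally show "(\<Sum>w<n. edge_row d p (u, v) (w, i) * x w i) = (p u i - p v i) * (x u i - x v i)" .
  qed
  finally show ?thesis .
qed

text \<open>The inner product of two rows is an integer depending on shared endpoints times the
  scalar product of the two edge vectors. By polarization the latter is a combination of four
  squared distances.\<close>

lemma sum_edge_row_edge_row:
  assumes "u < n" "v < n"
  shows "(\<Sum>w<n. \<Sum>i<d. edge_row d p (u, v) (w, i) * edge_row d p (a, b) (w, i)) =
    ((if u = a then 1 else 0) - (if u = b then 1 else 0) - (if v = a then 1 else 0) + (if v = b then 1 else 0)) *
    (sqdist d p u b + sqdist d p v a - sqdist d p u a - sqdist d p v b) / 2"
proof -
  define k :: real where "k = (if u = a then 1 else 0) - (if u = b then 1 else 0) - (if v = a then 1 else 0) + (if v = b then 1 else 0)"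
  have "(\<Sum>w<n. \<Sum>i<d. edge_row d p (u, v) (w, i) * edge_row d p (a, b) (w, i)) =
      (\<Sum>i<d. (p u i - p v i) * (edge_row d p (a, b) (u, i) - edge_row d p (a, b) (v, i)))"
    by (rule sum_edge_row[OF assms])
  also have "\<dots> = (\<Sum>i<d. k / 2 * ((p u i - p b i)\<^sup>2 + (p v i - p a i)\<^sup>2 - (p u i - p a i)\<^sup>2 - (p v i - p b i)\<^sup>2))"
  proof (rule sum.cong[OF refl])
    fix i assume "i \<in> {..<d}"
    then have "edge_row d p (a, b) (u, i) - edge_row d p (a, b) (v, i) = k * (p a i - p b i)"
      by (simp add: edge_row_apply k_def algebra_simps)
    then show "(p u i - p v i) * (edge_row d p (a, b) (u, i) - edge_row d p (a, b) (v, i)) =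
        k / 2 * ((p u i - p b i)\<^sup>2 + (p v i - p a i)\<^sup>2 - (p u i - p a i)\<^sup>2 - (p v i - p b i)\<^sup>2)"
      by (simp only:) (simp add: power2_eq_square algebra_simps)
  qed
  also have "\<dots> = k * (sqdist d p u b + sqdist d p v a - sqdist d p u a - sqdist d p v b) / 2"
    unfolding sqdist_def by (simp only: sum_distrib_left[symmetric] sum.distrib sum_subtractf)
  finally show ?thesis unfolding k_def .
qed

text \<open>The Gram matrix of the rows depends only on the pairwise distances.\<close>

lemma rk_full_congruent:
  assumes P: "P \<subseteq> {..<n} \<times> {..<n}" and full: "rk d p P = card P"
    and cong: "\<And>u v. \<lbrakk>u < n; v < n\<rbrakk> \<Longrightarrow> sqdist d q u v = sqdist d p u v"
  shows "rk d q P = card P"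
proof -
  have fin: "finite P" using P by (rule finite_subset) simp
  \<comment> \<open>\<open>Q x c\<close> is the squared norm of a combination of rows, that is, the
    quadratic form of their Gram matrix; it vanishes exactly at the dependencies.\<close>
  define Q where "Q x c = (\<Sum>w<n. \<Sum>i<d. (\<Sum>e\<in>P. c e * edge_row d x e (w, i))\<^sup>2)" for x c
  have Q_eq: "Q x c = (\<Sum>e\<in>P. \<Sum>f\<in>P. c e * c f * (\<Sum>w<n. \<Sum>i<d. edge_row d x e (w, i) * edge_row d x f (w, i)))"
    for x c
  proof -
    have "Q x c = (\<Sum>w<n. \<Sum>i<d. \<Sum>e\<in>P. \<Sum>f\<in>P. c e * c f * (edge_row d x e (w, i) * edge_row d x f (w, i)))"
      unfolding Q_def power2_eq_square sum_product by (simp add: mult_ac)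
    also have "\<dots> = (\<Sum>w<n. \<Sum>e\<in>P. \<Sum>i<d. \<Sum>f\<in>P. c e * c f * (edge_row d x e (w, i) * edge_row d x f (w, i)))"
      by (intro sum.cong refl) (rule sum.swap)
    also have "\<dots> = (\<Sum>e\<in>P. \<Sum>w<n. \<Sum>i<d. \<Sum>f\<in>P. c e * c f * (edge_row d x e (w, i) * edge_row d x f (w, i)))"
      by (rule sum.swap)
    also have "\<dots> = (\<Sum>e\<in>P. \<Sum>w<n. \<Sum>f\<in>P. \<Sum>i<d. c e * c f * (edge_row d x e (w, i) * edge_row d x f (w, i)))"
      by (intro sum.cong refl) (rule sum.swap)
    also have "\<dots> = (\<Sum>e\<in>P. \<Sum>f\<in>P. \<Sum>w<n. \<Sum>i<d. c e * c f * (edge_row d x e (w, i) * edge_row d x f (w, i)))"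
      by (intro sum.cong refl) (rule sum.swap)
    finally show ?thesis by (simp only: sum_distrib_left)
  qed
  have gram: "(\<Sum>w<n. \<Sum>i<d. edge_row d q e (w, i) * edge_row d q f (w, i)) =
      (\<Sum>w<n. \<Sum>i<d. edge_row d p e (w, i) * edge_row d p f (w, i))" if ef: "e \<in> P" "f \<in> P" for e f
  proof -
    obtain u v where e: "e = (u, v)" by (cases e)
    obtain a b where f: "f = (a, b)" by (cases f)
    have lt: "u < n" "v < n" "a < n" "b < n" using ef P e f by auto
    show ?thesis
      unfolding e f sum_edge_row_edge_row[OF lt(1,2)] by (simp only: cong lt)
  qed
  have "\<forall>e\<in>P. c e = 0" if c: "\<forall>j. (\<Sum>e\<in>P. c e * edge_row d q e j) = 0" for c
  proof -
    have "Q p c = Q q c" unfolding Q_eq by (intro sum.cong refl) (simp add: gram)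
    also have "\<dots> = 0" unfolding Q_def using c by simp
    finally have Q0: "Q p c = 0" .
    have zero: "(\<Sum>e\<in>P. c e * edge_row d p e (w, i)) = 0" for w i
    proof (cases "w < n \<and> i < d")
      case True
      have "\<forall>w\<in>{..<n}. (\<Sum>i<d. (\<Sum>e\<in>P. c e * edge_row d p e (w, i))\<^sup>2) = 0"
        using Q0 unfolding Q_def
        by (subst (asm) sum_nonneg_eq_0_iff) (auto intro: sum_nonneg)
      then have "(\<Sum>i<d. (\<Sum>e\<in>P. c e * edge_row d p e (w, i))\<^sup>2) = 0" using True by simp
      then have "\<forall>i\<in>{..<d}. (\<Sum>e\<in>P. c e * edge_row d p e (w, i))\<^sup>2 = 0"
        by (subst (asm) sum_nonneg_eq_0_iff) auto
      then show ?thesis using True by simp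
    next
      case False
      have "edge_row d p e (w, i) = 0" if "e \<in> P" for e
      proof -
        have "fst e < n" "snd e < n" using P that by auto
        then show ?thesis using False by (auto simp: edge_row_def case_prod_beta)
      qed
      then show ?thesis by simp
    qed
    then have "\<forall>j. (\<Sum>e\<in>P. c e * edge_row d p e j) = 0" by simp
    then show ?thesis using full fv_indep_iff[OF fin, of "edge_row d p"] unfolding rk_def by blast
  qed
  then show ?thesis unfolding rk_def using fv_indep_iff[OF fin, of "edge_row d q"] by blast
qed

text \<open>The averaging trick: the difference of two frameworks with equal edge lengths is an
  infinitesimal motion of their midpoint.\<close>

lemma sum_edge_row_midpoint:
  assumes "u < n" "v < n"
  shows "(\<Sum>w<n. \<Sum>i<d. edge_row d (\<lambda>u i. (x u i + y u i) / 2) (u, v) (w, i) * (y w i - x w i)) =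
    (sqdist d y u v - sqdist d x u v) / 2"
proof -
  have "(\<Sum>w<n. \<Sum>i<d. edge_row d (\<lambda>u i. (x u i + y u i) / 2) (u, v) (w, i) * (y w i - x w i)) =
      (\<Sum>i<d. ((y u i - y v i)\<^sup>2 - (x u i - x v i)\<^sup>2) / 2)"
    unfolding sum_edge_row[OF assms, of d _ "\<lambda>w i. y w i - x w i"]
    by (intro sum.cong refl) (simp add: power2_eq_square field_simps)
  then show ?thesis
    unfolding sqdist_def by (simp add: sum_subtractf sum_divide_distrib[symmetric])
qed

text \<open>Pairing with \<open>y - x\<close> is a linear form \<open>L\<close> on rows. It is 0 on
  the rows of edges, and at full rank these span the rows of all pairs.\<close>

lemma congruent_if_midpoint_full_rank:
  assumes E: "simple_graph n E"
    and len: "\<And>u v. {u, v} \<in> E \<Longrightarrow> sqdist d y u v = sqdist d x u v"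
    and rank: "rk d m ({..<n} \<times> {..<n}) \<le> rk d m (edge_pairs E)"
    and m: "m = (\<lambda>u i. (x u i + y u i) / 2)"
    and "u < n" "v < n"
  shows "sqdist d y u v = sqdist d x u v"
proof -
  define L where "L f = (\<Sum>w<n. \<Sum>i<d. f (w, i) * (y w i - x w i))" for f :: "nat \<times> nat \<Rightarrow> real"
  have L_row: "L (edge_row d m (u, v)) = (sqdist d y u v - sqdist d x u v) / 2" if "u < n" "v < n" for u v
    unfolding L_def m by (rule sum_edge_row_midpoint[OF that])
  have "edge_row d m (u, v) \<in> fv.span (edge_row d m ` edge_pairs E)"
  proof -
    have "edge_row d m ` ({..<n} \<times> {..<n}) \<subseteq> fv.span (edge_row d m ` edge_pairs E)"
      using rank edge_pairs_sub[OF E] unfolding rk_def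
      by (intro fv.subset_span_if_dim_le) auto
    then show ?thesis using assms(5,6) by blast
  qed
  then have "L (edge_row d m (u, v)) = 0"
  proof (induction rule: fv.span_induct_alt)
    case base
    show ?case by (simp add: L_def)
  next
    case (step c f g)
    then obtain a b where ab: "f = edge_row d m (a, b)" "(a, b) \<in> edge_pairs E" by auto
    then have "a < n" "b < n" using edge_pairs_sub[OF E] by auto
    then have "L f = (sqdist d y a b - sqdist d x a b) / 2" unfolding ab(1) by (rule L_row)
    then have "L f = 0" using len[of a b] ab(2) by (simp add: edge_pairs_def)
    have lin: "L ((\<lambda>j. c * f j) + g) = c * L f + L g"
      by (simp add: L_def sum.distrib sum_distrib_left distrib_right mult.assoc)
    show ?case unfolding lin using \<open>L f = 0\<close> step.IH by simp
  qed
  then show ?thesis using L_row[OF assms(5,6)] by simp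
qed

text \<open>The times at which all distances agree with those of \<open>p\<close> form a set
  containing 0 that is both closed and open in the unit interval, hence all of it.\<close>

lemma rigid_framework_if_full_rank:
  assumes gen: "generic n d p" and E: "simple_graph n E"
    and rank: "rk d p ({..<n} \<times> {..<n}) \<le> rk d p (edge_pairs E)"
  shows "rigid_framework n d E p"
  unfolding rigid_framework_def
proof (intro notI, elim exE conjE)
  fix q :: "real \<Rightarrow> nat \<Rightarrow> nat \<Rightarrow> real"
  assume cont: "\<forall>u<n. \<forall>i<d. continuous_on {0..1} (\<lambda>t. q t u i)"
    and q0: "\<forall>u<n. \<forall>i<d. q 0 u i = p u i"
    and len: "\<forall>t\<in>{0..1}. \<forall>u v. {u, v} \<in> E \<longrightarrow> sqdist d (q t) u v = sqdist d p u v"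
    and moved: "\<exists>t\<in>{0..1}. \<exists>u<n. \<exists>v<n. sqdist d (q t) u v \<noteq> sqdist d p u v"
  define Z where "Z = {t \<in> {0..1}. \<forall>u<n. \<forall>v<n. sqdist d (q t) u v = sqdist d p u v}"
  have finE: "finite (edge_pairs E)" using edge_pairs_sub[OF E] by (rule finite_subset) simp
  obtain B where B: "B \<subseteq> edge_pairs E" "card B = rk d p (edge_pairs E)" "rk d p B = card B"
    using fv.obtain_indep_subfamily[OF finE, of "edge_row d p"] unfolding rk_def by metis
  have B_sub: "B \<subseteq> {..<n} \<times> {..<n}" using B(1) edge_pairs_sub[OF E] by (rule order_trans)
  have "closedin (top_of_set {0..1}) Z"
  proof -
    let ?D = "\<lambda>t. \<Sum>u<n. \<Sum>v<n. (sqdist d (q t) u v - sqdist d p u v)\<^sup>2"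
    have "continuous_on {0..1} ?D"
      unfolding sqdist_def using cont by (intro continuous_on_sum continuous_on_power
          continuous_on_diff continuous_on_const) auto
    then have "closedin (top_of_set {0..1}) {t \<in> {0..1}. ?D t = 0}"
      by (rule continuous_closedin_preimage_constant)
    moreover have "?D t = 0 \<longleftrightarrow> (\<forall>u<n. \<forall>v<n. sqdist d (q t) u v = sqdist d p u v)" for t
    proof -
      have "?D t = 0 \<longleftrightarrow> (\<forall>u\<in>{..<n}. (\<Sum>v<n. (sqdist d (q t) u v - sqdist d p u v)\<^sup>2) = 0)"
        by (intro sum_nonneg_eq_0_iff) (auto intro: sum_nonneg)
      also have "\<dots> \<longleftrightarrow> (\<forall>u\<in>{..<n}. \<forall>v\<in>{..<n}. (sqdist d (q t) u v - sqdist d p u v)\<^sup>2 = 0)"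
        by (intro ball_cong refl sum_nonneg_eq_0_iff) auto
      finally show ?thesis by auto
    qed
    ultimately show ?thesis unfolding Z_def by simp
  qed
  moreover have "openin (top_of_set {0..1}) Z"
  proof (subst openin_subopen, intro ballI)
    fix t0 assume t0: "t0 \<in> Z"
    \<comment> \<open>The placement \<open>q t0\<close> is congruent to \<open>p\<close> but need
      not be generic; its rank is secured by the Gram matrix.\<close>
    have "rk d (q t0) B = card B"
      using t0 by (intro rk_full_congruent[OF B_sub B(3)]) (auto simp: Z_def)
    then obtain h where h: "h \<in> ratpoly ({0..<n} \<times> {0..<d})" "h (case_prod (q t0)) \<noteq> 0"
      "\<forall>m. h (case_prod m) \<noteq> 0 \<longrightarrow> rk d m B = card B"
      using rk_full_witness[OF B_sub] by blast
    define m where "m t = (\<lambda>u i. (q t0 u i + q t u i) / 2)" for t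
    have m_t0: "m t0 = q t0" by (simp add: m_def)
    have "continuous_on {0..1} (\<lambda>t. h (case_prod (m t)))"
    proof (rule continuous_on_ratpoly[OF h(1)])
      fix j assume "j \<in> {0..<n} \<times> {0..<d}"
      then obtain u i where j: "j = (u, i)" "u < n" "i < d" by auto
      have "continuous_on {0..1} (\<lambda>t. (q t0 u i + q t u i) / 2)"
        using cont j by (intro continuous_intros) auto
      then show "continuous_on {0..1} (\<lambda>t. case_prod (m t) j)" by (simp add: m_def j)
    qed
    then have "openin (top_of_set {0..1}) ({0..1} \<inter> (\<lambda>t. h (case_prod (m t))) -` (- {0}))"
      by (rule continuous_openin_preimage_gen) (rule open_Compl[OF closed_singleton])
    moreover have "t0 \<in> {0..1} \<inter> (\<lambda>t. h (case_prod (m t))) -` (- {0})"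
      using h(2) t0 by (simp add: m_t0 Z_def)
    moreover have "{0..1} \<inter> (\<lambda>t. h (case_prod (m t))) -` (- {0}) \<subseteq> Z"
    proof
      fix t assume t: "t \<in> {0..1} \<inter> (\<lambda>t. h (case_prod (m t))) -` (- {0})"
      \<comment> \<open>The midpoint need not be generic either. The generic rank bounds the rank of
        all pairs from above, and the certified rows \<open>B\<close> bound the rank of
        \<open>E\<close> from below by the same number.\<close>
      have "rk d (m t) ({..<n} \<times> {..<n}) \<le> rk d p ({..<n} \<times> {..<n})"
        by (rule rk_le_generic[OF gen]) simp
      also have "\<dots> \<le> rk d p (edge_pairs E)" by (rule rank)
      also have "\<dots> = rk d (m t) B" using h(3) t B(2) by simp
      also have "\<dots> \<le> rk d (m t) (edge_pairs E)" by (rule rk_subset[OF finE B(1)])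
      finally have full: "rk d (m t) ({..<n} \<times> {..<n}) \<le> rk d (m t) (edge_pairs E)" .
      have "sqdist d (q t) u v = sqdist d (q t0) u v" if "u < n" "v < n" for u v
      proof (rule congruent_if_midpoint_full_rank[OF E _ full _ that])
        show "sqdist d (q t) a b = sqdist d (q t0) a b" if "{a, b} \<in> E" for a b
          using len t t0 that by (simp add: Z_def)
      qed (simp add: m_def)
      then show "t \<in> Z" using t t0 by (simp add: Z_def)
    qed
    ultimately show "\<exists>T. openin (top_of_set {0..1}) T \<and> t0 \<in> T \<and> T \<subseteq> Z" by blast
  qed
  moreover have "0 \<in> Z"
    using q0 by (simp add: Z_def sqdist_def)
  ultimately have "Z = {0..1}"
    using iffD1[OF connected_clopen connected_Icc[of 0 "1 :: real"]] by blast
  then show False using moved unfolding Z_def by blast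
qed

subsection \<open>The extremal graph\<close>

text \<open>The directions at \<open>a0\<close> together with the vectors \<open>y k\<close> are
  linearly independent in dimension \<open>d\<close>: pairing a dependency with \<open>y l\<close>
  isolates the coefficient of \<open>y l\<close>.\<close>

lemma card_orthogonal_le:
  fixes y :: "nat \<Rightarrow> nat \<Rightarrow> real"
  assumes indep: "aff_indep d p (insert a0 A)" and A: "finite A" "a0 \<notin> A" and K: "finite K"
    and orth: "\<And>k l. \<lbrakk>k \<in> K; l \<in> K; k \<noteq> l\<rbrakk> \<Longrightarrow> (\<Sum>i<d. y k i * y l i) = 0"
    and nz: "\<And>k. k \<in> K \<Longrightarrow> \<exists>i<d. y k i \<noteq> 0"
    and perp: "\<And>a k. \<lbrakk>a \<in> A; k \<in> K\<rbrakk> \<Longrightarrow> (\<Sum>i<d. (p a0 i - p a i) * y k i) = 0"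
  shows "card A + card K \<le> d"
proof (rule ccontr)
  assume "\<not> ?thesis"
  then have "card {..<d} < card (A <+> K)" using A K by (simp add: card_Plus)
  moreover define f where "f = case_sum (\<lambda>a i. p a0 i - p a i) y"
  ultimately obtain c where c: "\<exists>z\<in>A <+> K. c z \<noteq> 0"
    "\<And>i. i \<in> {..<d} \<Longrightarrow> (\<Sum>z\<in>A <+> K. c z * f z i) = 0"
    using exists_linear_dependency[of "{..<d}" "A <+> K" f] A K by auto
  have split: "(\<Sum>a\<in>A. c (Inl a) * (p a0 i - p a i)) + (\<Sum>k\<in>K. c (Inr k) * y k i) = 0" if "i < d" for i
    using c(2)[of i] that A K by (simp add: sum.Plus f_def)
  have cK: "c (Inr l) = 0" if l: "l \<in> K" for l
  proof -
    have pos: "(\<Sum>i<d. y l i * y l i) \<noteq> 0"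
    proof
      assume "(\<Sum>i<d. y l i * y l i) = 0"
      then have "\<forall>i\<in>{..<d}. y l i * y l i = 0" by (subst (asm) sum_nonneg_eq_0_iff) auto
      then show False using nz[OF l] by auto
    qed
    have "0 = (\<Sum>i<d. ((\<Sum>a\<in>A. c (Inl a) * (p a0 i - p a i)) + (\<Sum>k\<in>K. c (Inr k) * y k i)) * y l i)"
      using split by simp
    also have "\<dots> = (\<Sum>i<d. \<Sum>a\<in>A. c (Inl a) * ((p a0 i - p a i) * y l i)) +
        (\<Sum>i<d. \<Sum>k\<in>K. c (Inr k) * (y k i * y l i))"
      by (simp add: distrib_right sum_distrib_right sum.distrib mult.assoc)
    also have "(\<Sum>i<d. \<Sum>a\<in>A. c (Inl a) * ((p a0 i - p a i) * y l i)) =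
        (\<Sum>a\<in>A. \<Sum>i<d. c (Inl a) * ((p a0 i - p a i) * y l i))"
      by (rule sum.swap)
    also have "\<dots> = 0" using perp l by (simp add: sum_distrib_left[symmetric])
    also have "(\<Sum>i<d. \<Sum>k\<in>K. c (Inr k) * (y k i * y l i)) =
        (\<Sum>k\<in>K. \<Sum>i<d. c (Inr k) * (y k i * y l i))"
      by (rule sum.swap)
    also have "\<dots> = (\<Sum>k\<in>K. if k = l then c (Inr l) * (\<Sum>i<d. y l i * y l i) else 0)"
      using orth l by (intro sum.cong) (auto simp: sum_distrib_left[symmetric])
    also have "\<dots> = c (Inr l) * (\<Sum>i<d. y l i * y l i)" using l K by simp
    finally show ?thesis using pos by simp
  qed
  have "\<forall>i<d. (\<Sum>a\<in>A. c (Inl a) * (p a0 i - p a i)) = 0" using split cK by simp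
  then have "\<forall>a\<in>A. c (Inl a) = 0"
    by (rule aff_indep_star[OF indep A])
  then show False using c(1) cK by auto
qed

text \<open>Only \<open>d - 1\<close> points are fixed, so \<open>p u\<close> can be rotated in a plane (spanned by \<open>z\<close>
  and \<open>w\<close> below) orthogonal to their affine span.\<close>

lemma exists_flex_of_vertex:
  assumes indep: "aff_indep d p (insert u S)" and S: "finite S" "u \<notin> S" "card S = d - 1" and d: "d > 0"
  obtains x :: "real \<Rightarrow> nat \<Rightarrow> real" where "\<And>i. continuous_on {0..1} (\<lambda>t. x t i)" "x 0 = p u"
    "\<exists>i<d. x 1 i \<noteq> p u i"
    "\<And>t s. s \<in> S \<Longrightarrow> (\<Sum>i<d. (x t i - p s i)\<^sup>2) = (\<Sum>i<d. (p u i - p s i)\<^sup>2)"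
proof (cases "d = 1")
  case True
  then have "S = {}" using S by simp
  show ?thesis
  proof (rule that[of "\<lambda>t i. p u i + t"])
    show "continuous_on {0..1} (\<lambda>t. p u i + t)" for i by (intro continuous_intros)
  qed (use d \<open>S = {}\<close> in auto)
next
  case False
  then have "S \<noteq> {}" using S d by auto
  then obtain s0 where s0: "s0 \<in> S" by blast
  \<comment> \<open>With a fixed point \<open>s0\<close> as base, \<open>u\<close> becomes one of
    \<open>d - 1\<close> directions. The vector \<open>w\<close> is orthogonal to all of them; for
    \<open>z\<close> the condition at \<open>u\<close> is traded for orthogonality to
    \<open>w\<close>.\<close>
  define A where "A = insert u (S - {s0})"
  have A: "finite A" "s0 \<notin> A" "insert s0 A = insert u S" using S s0 by (auto simp: A_def)
  have cardA: "card A = d - 1"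
    using S s0 False d by (simp add: A_def card_Diff_singleton)
  then have lt: "card A < card {..<d}" using d by simp
  obtain w where w: "\<exists>i\<in>{..<d}. w i \<noteq> 0" "\<And>a. a \<in> A \<Longrightarrow> (\<Sum>i<d. w i * (p s0 i - p a i)) = 0"
    using exists_linear_dependency[OF A(1) finite_lessThan lt, of "\<lambda>i a. p s0 i - p a i"] by blast
  obtain z where z: "\<exists>i\<in>{..<d}. z i \<noteq> 0"
    "\<And>a. a \<in> A \<Longrightarrow> (\<Sum>i<d. z i * (if a = u then w i else p s0 i - p a i)) = 0"
    using exists_linear_dependency[OF A(1) finite_lessThan lt, of "\<lambda>i a. if a = u then w i else p s0 i - p a i"]
    by blast
  have zw: "(\<Sum>i<d. z i * w i) = 0" using z(2)[of u] by (simp add: A_def)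
  have zS: "(\<Sum>i<d. z i * (p s0 i - p s i)) = 0" if "s \<in> S" for s
  proof (cases "s = s0")
    case False
    then have "s \<in> A" "s \<noteq> u" using that S by (auto simp: A_def)
    then show ?thesis using z(2)[of s] by simp
  qed simp
  have wS: "(\<Sum>i<d. w i * (p s0 i - p s i)) = 0" if "s \<in> insert u S" for s
    using w(2)[of s] that by (cases "s = s0") (auto simp: A_def)
  have pos: "(\<Sum>i<d. v i * v i) > 0" if v: "\<exists>i\<in>{..<d}. v i \<noteq> 0" for v :: "nat \<Rightarrow> real"
  proof -
    obtain i where i: "i < d" "v i \<noteq> 0" using v by blast
    have "0 < v i * v i" using i(2) by (simp add: zero_less_mult_iff linorder_neq_iff disj_commute)
    also have "\<dots> \<le> (\<Sum>i<d. v i * v i)" using i(1) by (intro member_le_sum) auto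
    finally show ?thesis .
  qed
  define Z W where "Z = (\<Sum>i<d. z i * z i)" and "W = (\<Sum>i<d. w i * w i)"
  have ZW: "Z > 0" "W > 0" using pos[OF z(1)] pos[OF w(1)] by (simp_all add: Z_def W_def)
  \<comment> \<open>The coordinate of \<open>p u - p s0\<close> along \<open>z\<close>. Were it 0,
    \<open>z\<close> and \<open>w\<close> would both be orthogonal to \<open>d - 1\<close>
    independent directions, one vector too many for dimension \<open>d\<close>.\<close>
  define a where "a = (\<Sum>i<d. z i * (p u i - p s0 i)) / Z"
  have a: "a \<noteq> 0"
  proof
    assume "a = 0"
    then have zu: "(\<Sum>i<d. z i * (p s0 i - p u i)) = 0"
      using ZW by (simp add: a_def right_diff_distrib sum_subtractf)
    define y where "y k = (if k = 0 then z else w)" for k :: nat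
    have "card A + card {0, 1 :: nat} \<le> d"
    proof (rule card_orthogonal_le[where y = y and p = p and ?a0.0 = s0])
      show "aff_indep d p (insert s0 A)" using indep A(3) by simp
      show "(\<Sum>i<d. y k i * y l i) = 0" if "k \<in> {0, 1}" "l \<in> {0, 1}" "k \<noteq> l" for k l
        using that zw by (auto simp: y_def mult.commute)
      show "\<exists>i<d. y k i \<noteq> 0" for k using z(1) w(1) by (auto simp: y_def)
      show "(\<Sum>i<d. (p s0 i - p b i) * y k i) = 0" if "b \<in> A" for b k
        using that zS[of b] wS[of b] zu by (auto simp: y_def A_def mult.commute)
    qed (use A in auto)
    then show False using cardA d by simp
  qed
  \<comment> \<open>Since \<open>z\<close> and \<open>w\<close> may differ in length,
    \<open>b\<close> is scaled so that the orbit is a circle; its centre is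
    \<open>p u - a * z\<close>.\<close>
  define b where "b = a * sqrt (Z / W)"
  have b: "b\<^sup>2 * W = a\<^sup>2 * Z" "b \<noteq> 0"
    using ZW a by (simp_all add: b_def power_mult_distrib)
  define x where "x t i = p u i - a * z i + a * cos t * z i + b * sin t * w i" for t i
  have "(\<Sum>i<d. (x t i - p s i)\<^sup>2) = (\<Sum>i<d. (p u i - a * z i - p s i)\<^sup>2) + a\<^sup>2 * Z" if s: "s \<in> S" for t s
  proof -
    let ?e = "\<lambda>i. p u i - a * z i - p s i"
    have e: "?e i = (p u i - p s0 i) + (p s0 i - p s i) - a * z i"
      "?e i = - (p s0 i - p u i) + (p s0 i - p s i) - a * z i" for i by auto
    have ez: "(\<Sum>i<d. z i * ?e i) = 0"
    proof -
      have "(\<Sum>i<d. z i * ?e i) = (\<Sum>i<d. z i * (p u i - p s0 i)) +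
          (\<Sum>i<d. z i * (p s0 i - p s i)) - a * Z"
        unfolding e(1) Z_def sum_distrib_left sum.distrib[symmetric] sum_subtractf[symmetric]
        by (intro sum.cong) (auto simp: algebra_simps)
      then show ?thesis using zS[OF s] ZW by (simp add: a_def)
    qed
    have ew: "(\<Sum>i<d. w i * ?e i) = 0"
    proof -
      have "(\<Sum>i<d. w i * ?e i) = - (\<Sum>i<d. w i * (p s0 i - p u i)) +
          (\<Sum>i<d. w i * (p s0 i - p s i)) - a * (\<Sum>i<d. z i * w i)"
        unfolding e(2) sum_distrib_left sum_negf[symmetric] sum.distrib[symmetric] sum_subtractf[symmetric]
        by (intro sum.cong) (auto simp: algebra_simps)
      then show ?thesis using wS[of u] wS[of s] s zw by simp
    qed
    have "(\<Sum>i<d. (x t i - p s i)\<^sup>2) = (\<Sum>i<d. (?e i)\<^sup>2 + (a * cos t)\<^sup>2 * (z i * z i) +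
        (b * sin t)\<^sup>2 * (w i * w i) + 2 * (a * cos t) * (z i * ?e i) + 2 * (b * sin t) * (w i * ?e i) +
        2 * (a * cos t) * (b * sin t) * (z i * w i))"
      by (intro sum.cong) (simp_all add: x_def power2_eq_square algebra_simps)
    also have "\<dots> = (\<Sum>i<d. (?e i)\<^sup>2) + (a * cos t)\<^sup>2 * Z + (b * sin t)\<^sup>2 * W +
        2 * (a * cos t) * (\<Sum>i<d. z i * ?e i) + 2 * (b * sin t) * (\<Sum>i<d. w i * ?e i) +
        2 * (a * cos t) * (b * sin t) * (\<Sum>i<d. z i * w i)"
      unfolding Z_def W_def by (simp only: sum.distrib sum_distrib_left)
    also have "\<dots> = (\<Sum>i<d. (?e i)\<^sup>2) + (a * cos t)\<^sup>2 * Z + (b * sin t)\<^sup>2 * W"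
      unfolding ez ew zw by simp
    also have "(b * sin t)\<^sup>2 * W = (sin t)\<^sup>2 * (a\<^sup>2 * Z)"
      unfolding b(1)[symmetric] by (simp add: power_mult_distrib)
    also have "(\<Sum>i<d. (?e i)\<^sup>2) + (a * cos t)\<^sup>2 * Z + (sin t)\<^sup>2 * (a\<^sup>2 * Z) =
        (\<Sum>i<d. (?e i)\<^sup>2) + ((cos t)\<^sup>2 + (sin t)\<^sup>2) * (a\<^sup>2 * Z)"
      by (simp only: power_mult_distrib distrib_right distrib_left mult_ac add_ac)
    finally show ?thesis by simp
  qed
  note const = this
  have x0: "x 0 = p u" by (simp add: x_def fun_eq_iff)
  have "\<exists>i<d. x 1 i \<noteq> p u i"
  proof (rule ccontr)
    assume "\<not> ?thesis"
    then have "0 = (\<Sum>i<d. w i * (x 1 i - p u i))" by simp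
    also have "\<dots> = (\<Sum>i<d. (a * cos 1 - a) * (z i * w i) + b * sin 1 * (w i * w i))"
      by (intro sum.cong) (simp_all add: x_def algebra_simps)
    also have "\<dots> = (a * cos 1 - a) * (\<Sum>i<d. z i * w i) + b * sin 1 * W"
      unfolding W_def by (simp only: sum.distrib sum_distrib_left)
    finally have "b * sin 1 * W = 0" using zw by simp
    moreover have "sin (1 :: real) > 0" using pi_gt3 by (intro sin_gt_zero) auto
    ultimately show False using b(2) ZW by simp
  qed
  moreover have "continuous_on {0..1} (\<lambda>t. x t i)" for i
    unfolding x_def by (intro continuous_intros)
  moreover have "(\<Sum>i<d. (x t i - p s i)\<^sup>2) = (\<Sum>i<d. (p u i - p s i)\<^sup>2)" if s: "s \<in> S" for t s
    using const[OF s, of t] const[OF s, of 0] unfolding x0 by simp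
  ultimately show ?thesis using x0 by (intro that[of x])
qed

section \<open>The graph attaining the lower bound\<close>

definition pendant_graph :: "nat \<Rightarrow> nat \<Rightarrow> nat set set" where
  "pendant_graph n d = {{a, b} | a b. a < n - 1 \<and> b < n - 1 \<and> a \<noteq> b} \<union> {{n - 1, b} | b. b < d - 1}"

lemma pendant_graph_iff:
  assumes "d + 2 \<le> n"
  shows "{a, b} \<in> pendant_graph n d \<longleftrightarrow> a < n - 1 \<and> b < n - 1 \<and> a \<noteq> b \<or>
    a = n - 1 \<and> b < d - 1 \<or> b = n - 1 \<and> a < d - 1"
  unfolding pendant_graph_def using assms by (auto simp: doubleton_eq_iff)

lemma pendant_graph_simple:
  assumes "d + 2 \<le> n"
  shows "simple_graph n (pendant_graph n d)"
  unfolding simple_graph_def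
proof
  fix e assume e: "e \<in> pendant_graph n d"
  then obtain a b where ab: "e = {a, b}" unfolding pendant_graph_def by blast
  then have "a \<noteq> b" "a < n" "b < n" using e pendant_graph_iff[OF assms, of a b] assms by auto
  then show "\<exists>u v. e = {u, v} \<and> u \<noteq> v \<and> u < n \<and> v < n" using ab by blast
qed

lemma pendant_graph_eta:
  assumes n: "d + 2 \<le> n" and d: "d > 0"
  shows "enat (n + d - 3) \<le> eta n (pendant_graph n d)"
  unfolding eta_def
proof (rule INF_greatest, clarsimp)
  let ?E = "pendant_graph n d"
  have "{v. {n - 1, v} \<in> ?E} = {..<d - 1}"
    using n by (auto simp: pendant_graph_iff[OF n])
  then have deg_u: "degree ?E (n - 1) = d - 1" by (simp add: degree_def)
  have deg_b: "n - 2 \<le> degree ?E b" if b: "b < n - 1" for b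
  proof -
    have "{..<n - 1} - {b} \<subseteq> {v. {b, v} \<in> ?E}" using b by (auto simp: pendant_graph_iff[OF n])
    moreover have "{v. {b, v} \<in> ?E} \<subseteq> {..<n}" using n by (auto simp: pendant_graph_iff[OF n])
    then have "finite {v. {b, v} \<in> ?E}" by (rule finite_subset) simp
    ultimately have "card ({..<n - 1} - {b}) \<le> degree ?E b"
      unfolding degree_def by (intro card_mono)
    then show ?thesis using b by simp
  qed
  fix a b assume ab: "a < n" "b < n" "a \<noteq> b" "{a, b} \<notin> ?E"
  then have "a = n - 1 \<and> b < n - 1 \<or> b = n - 1 \<and> a < n - 1"
    using n by (auto simp: pendant_graph_iff[OF n])
  then show "n + d - 3 \<le> degree ?E a + degree ?E b"
    using deg_u deg_b[of a] deg_b[of b] n d by auto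
qed

text \<open>Moving \<open>u\<close> on its circle keeps the edges, but some distance must be seen to
  change. If none did, the displacement of \<open>u\<close> would be orthogonal to the
  \<open>d\<close> independent directions from point 0 to points 1 to \<open>d\<close>;
  \<open>d + 2 \<le> n\<close> provides these points besides \<open>u\<close>.\<close>

lemma pendant_graph_not_rigid:
  assumes gen: "generic n d p" and n: "d + 2 \<le> n" and d: "d > 0"
  shows "\<not> rigid_framework n d (pendant_graph n d) p"
proof -
  define u where "u = n - 1"
  have indep: "aff_indep d p (insert u {..<d - 1})"
    using n by (intro generic_aff_indep[OF gen]) (auto simp: u_def card_insert_if)
  have u: "u \<notin> {..<d - 1}" using n by (simp add: u_def)
  show ?thesis
  proof (rule exists_flex_of_vertex[OF indep finite_lessThan u card_lessThan d])
    fix x :: "real \<Rightarrow> nat \<Rightarrow> real"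
    assume x: "\<And>i. continuous_on {0..1} (\<lambda>t. x t i)" "x 0 = p u" "\<exists>i<d. x 1 i \<noteq> p u i"
      "\<And>t s. s \<in> {..<d - 1} \<Longrightarrow> (\<Sum>i<d. (x t i - p s i)\<^sup>2) = (\<Sum>i<d. (p u i - p s i)\<^sup>2)"
    define q where "q t = p(u := x t)" for t :: real
    have q_other: "q t v i = p v i" if "v \<noteq> u" for t v i using that by (simp add: q_def)
    have q_u: "q t u i = x t i" for t i by (simp add: q_def)
    have sq_sym: "sqdist d r a b = sqdist d r b a" for r a b
      by (simp add: sqdist_def power2_commute)
    have "continuous_on {0..1} (\<lambda>t. q t v i)" for v i
      using x(1) by (cases "v = u") (simp_all add: q_other q_u)
    moreover have "q 0 v i = p v i" for v i
      using x(2) by (cases "v = u") (simp_all add: q_other q_u)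
    moreover have "sqdist d (q t) a b = sqdist d p a b" if "{a, b} \<in> pendant_graph n d" for t a b
    proof -
      have su: "sqdist d (q t) u s = sqdist d p u s" if "s < d - 1" for s
      proof -
        have "s \<noteq> u" using that n by (simp add: u_def)
        then show ?thesis using x(4)[of s t] that by (simp add: sqdist_def q_u q_other)
      qed
      consider "a \<noteq> u" "b \<noteq> u" | "a = u" "b < d - 1" | "b = u" "a < d - 1"
        using \<open>{a, b} \<in> pendant_graph n d\<close> by (auto simp: pendant_graph_iff[OF n] u_def)
      then show ?thesis
        using su[of a] su[of b] sq_sym[of "q t" a b] sq_sym[of p a b]
        by cases (simp_all add: sqdist_def q_other)
    qed
    moreover have "\<exists>v<n. sqdist d (q 1) u v \<noteq> sqdist d p u v"
    proof (rule ccontr)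
      assume "\<not> ?thesis"
      then have same: "sqdist d (q 1) u v = sqdist d p u v" if "v < n" for v using that by blast
      define y where "y = (\<lambda>(k :: nat) i. x 1 i - p u i)"
      have eq: "(\<Sum>i<d. 2 * ((p u i - p v i) * y 0 i)) + (\<Sum>i<d. (y 0 i)\<^sup>2) = 0" if v: "v < n - 1" for v
      proof -
        have vu: "v \<noteq> u" using v by (simp add: u_def)
        have "sqdist d (q 1) u v - sqdist d p u v =
            (\<Sum>i<d. 2 * ((p u i - p v i) * y 0 i) + (y 0 i)\<^sup>2)"
          using v unfolding sqdist_def sum_subtractf[symmetric]
          by (intro sum.cong) (simp_all add: q_u q_other[OF vu] y_def power2_eq_square algebra_simps)
        then show ?thesis using same[of v] v by (simp add: sum.distrib)
      qed
      have "card {1..d} + card {0 :: nat} \<le> d"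
      proof (rule card_orthogonal_le[where y = y and p = p and ?a0.0 = 0])
        show "aff_indep d p (insert 0 {1..d})"
          using n by (intro generic_aff_indep[OF gen]) (auto simp: card_insert_if)
        show "\<exists>i<d. y k i \<noteq> 0" for k using x(3) by (simp add: y_def)
        show "(\<Sum>i<d. (p 0 i - p a i) * y k i) = 0" if a: "a \<in> {1..d}" for a k
        proof -
          have "a < n - 1" "0 < n - 1" using a n by auto
          then have "(\<Sum>i<d. 2 * ((p u i - p a i) * y 0 i)) - (\<Sum>i<d. 2 * ((p u i - p 0 i) * y 0 i)) = 0"
            using eq[of a] eq[of 0] by linarith
          then have "(\<Sum>i<d. 2 * ((p 0 i - p a i) * y 0 i)) = 0"
            unfolding sum_subtractf[symmetric] by (simp add: algebra_simps)
          then show ?thesis by (simp add: sum_distrib_left[symmetric] y_def)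
        qed
      qed auto
      then show False by simp
    qed
    moreover have "u < n" using n by (simp add: u_def)
    ultimately show ?thesis unfolding rigid_framework_def not_not
      by (intro exI[of _ q]) (auto intro!: bexI[of _ 1])
  qed
qed

section \<open>The value of \<open>g\<close>\<close>

lemma d_rigid_if_ore:
  assumes "0 < d" "d * (d + 2) \<le> n" "simple_graph n E" "enat (n + d - 2) \<le> eta n E"
  shows "d_rigid n d E"
proof -
  obtain p0 where p0: "alg_indep ({0..<n} \<times> {0..<d}) p0"
    using exists_alg_indep[of "{0..<n} \<times> {0..<d}"] by auto
  define p where "p = curry p0"
  have gen: "generic n d p" using p0 by (simp add: generic_def p_def)
  have "n + d - 2 \<le> degree E u + degree E v" if "u < n" "v < n" "u \<noteq> v" "{u, v} \<notin> E" for u v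
  proof -
    have "eta n E \<le> enat (degree E (fst (u, v)) + degree E (snd (u, v)))"
      unfolding eta_def using that by (intro INF_lower) simp
    from order_trans[OF assms(4) this] show ?thesis by simp
  qed
  then have "rk d p ({..<n} \<times> {..<n}) \<le> rk d p (edge_pairs E)"
    by (rule ore_imp_full_rank[OF gen assms(1-3)])
  then show ?thesis
    using rigid_framework_if_full_rank[OF gen assms(3)] gen unfolding d_rigid_def by blast
qed

theorem theorem1p4:
  fixes n d :: nat
  assumes "0 < n" "0 < d" "n \<ge> d * (d + 2)"
  shows "g n d = n + d - 2"
  unfolding g_def
proof (rule Least_equality)
  show "\<forall>E. simple_graph n E \<longrightarrow> enat (n + d - 2) \<le> eta n E \<longrightarrow> d_rigid n d E"
    using d_rigid_if_ore assms(2,3) by blast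
next
  fix k assume k: "\<forall>E. simple_graph n E \<longrightarrow> enat k \<le> eta n E \<longrightarrow> d_rigid n d E"
  have n: "d + 2 \<le> n"
  proof -
    have "d + 2 \<le> d * (d + 2)" using assms(2) by (cases d) auto
    then show ?thesis using assms(3) by (rule order_trans)
  qed
  show "n + d - 2 \<le> k"
  proof (rule ccontr)
    assume "\<not> n + d - 2 \<le> k"
    then have "enat k \<le> enat (n + d - 3)" by simp
    also have "\<dots> \<le> eta n (pendant_graph n d)" using n assms(2) by (rule pendant_graph_eta)
    finally have "d_rigid n d (pendant_graph n d)"
      using k pendant_graph_simple[OF n] by blast
    then show False
      using pendant_graph_not_rigid[OF _ n assms(2)] unfolding d_rigid_def by blast
  qed
qed

end
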